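(* Let $G=(V,E)$, $\Delta$, $\epsilon$, $K$, $t_\epsilon$ be as in the context, and run the basic algorithm on $G$. Then with high probability, $\Delta(G_{t_\epsilon}\cup G_F)=O\left(\epsilon^{1/(3K)}\Delta\right)$.
   Context: Let $G=(V,E)$ be a simple graph with $|V|=n$. Let $\Delta>0$ and let $\epsilon$ satisfy $10^{-4}\ge \epsilon\ge 10\cdot(\ln n/\Delta)^{1/6}$, and assume every node of $G$ has degree in $[(1-\epsilon^2)\Delta,(1+\epsilon^2)\Delta]$. Let $K=48$ and $t_\epsilon=\lfloor \ln(1/\epsilon)/(2K\epsilon)\rfloor$. For a graph $H$, $\Delta(H)$ denotes its maximum degree. Two edges are adjacent if they share an endpoint; $N(e)$ is the set of edges adjacent to $e$. The basic algorithm. Phase one consists of rounds $i=1,\dots,t_\epsilon-1$, starting with $E_1=E$. In round $i$: each edge of $E_i$ is independently placed into $S_i$ with probability $\epsilon$. For each edge $e$, its palette is $P_i(e)=\{1,\dots,(1+\epsilon^2)\Delta\}\setminus\{c(e'): e'\in N(e)\cap\bigcup_{j<i}S_j\}$ (so tentative colors of all previously sampled edges, including failed ones, are excluded). Each $e\in S_i$ with $P_i(e)\neq\emptyset$ picks a tentative color $c(e)$ uniformly at random from $P_i(e)$, independently; if $P_i(e)=\emptyset$, set $c(e)=\text{null}$. The failed set is $F_i=\{e\in S_i: c(e)=\text{null}\text{ or } c(e)=c(e')\text{ for some } e'\in N(e)\cap S_i\}$. Each $e\in S_i\setminus F_i$ is colored $c(e)$. Set $E_{i+1}=E_i\setminus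 S_i$. After phase one, let $G_{t_\epsilon}=(V,E_{t_\epsilon})$ and $G_F=(V,\bigcup_i F_i)$. Phase two colors the edges of $G_{t_\epsilon}\cup G_F$ greedily using the new colors $(1+\epsilon^2)\Delta+1,\dots,(1+\epsilon^2)\Delta+2\Delta(G_{t_\epsilon}\cup G_F)-1$. "With high probability" means with probability at least $1-1/n^{c}$ for some constant $c>0$. *)

theory Defs
  imports "HOL-Probability.Probability" "HOL-Library.Monad_Syntax"
begin

section \<open>Graphs\<close>

text \<open>An edge is the two-element set of its endpoints.\<close>

definition simple_graph :: "'a set \<Rightarrow> 'a set set \<Rightarrow> bool" where
  "simple_graph V E \<longleftrightarrow> finite V \<and> E \<subseteq> {e. e \<subseteq> V \<and> card e = 2}"

definition vertex_degree :: "'a set set \<Rightarrow> 'a \<Rightarrow> nat" where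
  "vertex_degree E v = card {e \<in> E. v \<in> e}"

text \<open>On \<^typ>\<open>nat\<close> the supremum of a finite nonempty set is its maximum, and that of the
  empty set is 0.\<close>

definition max_degree :: "'a set \<Rightarrow> 'a set set \<Rightarrow> nat" where
  "max_degree V E = (SUP v\<in>V. vertex_degree E v)"

definition adjacent_edges :: "'a set set \<Rightarrow> 'a set \<Rightarrow> 'a set set" where
  "adjacent_edges E e = {e' \<in> E. e' \<noteq> e \<and> e \<inter> e' \<noteq> {}}"

section \<open>Phase one of the basic algorithm\<close>

definition nibble_K :: real where
  "nibble_K = 48"

definition t_eps :: "real \<Rightarrow> nat" where
  "t_eps \<epsilon> = nat \<lfloor>ln (1 / \<epsilon>) / (2 * nibble_K * \<epsilon>)\<rfloor>"

text \<open>The state before round \<open>i\<close>: \<open>unsampled\<close> is \<open>E\<^sub>i\<close>, \<open>sampled\<close> and \<open>failed\<close> are the unions of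
  \<open>S\<^sub>j\<close> and of \<open>F\<^sub>j\<close> over all \<open>j < i\<close>, and \<open>tentative\<close> holds the colors \<open>c(e)\<close>
  of the sampled edges, including the failed ones. The color null is \<^term>\<open>None\<close>; outside
  \<open>sampled\<close> the value of \<open>tentative\<close> is irrelevant.\<close>

record 'a nibble_state =
  unsampled :: "'a set set"
  sampled :: "'a set set"
  tentative :: "'a set \<Rightarrow> nat option"
  failed :: "'a set set"

definition initial_state :: "'a set set \<Rightarrow> 'a nibble_state" where
  "initial_state E = \<lparr>unsampled = E, sampled = {}, tentative = (\<lambda>_. None), failed = {}\<rparr>"

text \<open>The bound on the colors is real, so the largest color is its integer part.\<close>

definition palette :: "'a set set \<Rightarrow> real \<Rightarrow> real \<Rightarrow> 'a nibble_state \<Rightarrow> 'a set \<Rightarrow> nat set" where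
  "palette E \<Delta> \<epsilon> st e =
     {k. 1 \<le> k \<and> real k \<le> (1 + \<epsilon>\<^sup>2) * \<Delta>} -
     {k. \<exists>e' \<in> adjacent_edges E e \<inter> sampled st. tentative st e' = Some k}"

definition sample_edges :: "real \<Rightarrow> 'a set set \<Rightarrow> 'a set set pmf" where
  "sample_edges \<epsilon> U = map_pmf (\<lambda>b. {e \<in> U. b e}) (Pi_pmf U False (\<lambda>_. bernoulli_pmf \<epsilon>))"

definition pick_color :: "nat set \<Rightarrow> nat option pmf" where
  "pick_color P = (if P = {} then return_pmf None else map_pmf Some (pmf_of_set P))"

definition failed_edges ::
    "'a set set \<Rightarrow> 'a set set \<Rightarrow> ('a set \<Rightarrow> nat option) \<Rightarrow> 'a set set" where
  "failed_edges E S c =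
     {e \<in> S. c e = None \<or> (\<exists>e' \<in> adjacent_edges E e \<inter> S. c e = c e')}"

definition nibble_round ::
    "'a set set \<Rightarrow> real \<Rightarrow> real \<Rightarrow> 'a nibble_state \<Rightarrow> 'a nibble_state pmf" where
  "nibble_round E \<Delta> \<epsilon> st = do {
     S \<leftarrow> sample_edges \<epsilon> (unsampled st);
     c \<leftarrow> Pi_pmf S None (\<lambda>e. pick_color (palette E \<Delta> \<epsilon> st e));
     return_pmf
       \<lparr>unsampled = unsampled st - S,
        sampled = sampled st \<union> S,
        tentative = (\<lambda>e. if e \<in> S then c e else tentative st e),
        failed = failed st \<union> failed_edges E S c\<rparr>
   }"

primrec nibble_rounds ::
    "'a set set \<Rightarrow> real \<Rightarrow> real \<Rightarrow> nat \<Rightarrow> 'a nibble_state pmf" where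
  "nibble_rounds E \<Delta> \<epsilon> 0 = return_pmf (initial_state E)"
| "nibble_rounds E \<Delta> \<epsilon> (Suc r) = bind_pmf (nibble_rounds E \<Delta> \<epsilon> r) (nibble_round E \<Delta> \<epsilon>)"

definition phase_one :: "'a set set \<Rightarrow> real \<Rightarrow> real \<Rightarrow> 'a nibble_state pmf" where
  "phase_one E \<Delta> \<epsilon> = nibble_rounds E \<Delta> \<epsilon> (t_eps \<epsilon> - 1)"

text \<open>The edge set of \<open>G\<^sub>t \<union> G\<^sub>F\<close> with \<open>t = t\<^sub>\<epsilon>\<close>. This is the graph that phase two then colors
  deterministically with fresh colors.\<close>

definition leftover_edges :: "'a nibble_state \<Rightarrow> 'a set set" where
  "leftover_edges st = unsampled st \<union> failed st"

end

theory Submission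
  imports Defs
begin

text \<open>Two families of quantities are tracked through the rounds: the palette sizes of the unsampled
  edges, and the color degrees, i.e. the numbers of unsampled edges at \<open>u\<close> whose other endpoint
  has not used color \<open>k\<close>. In one round an edge or a color survives at each endpoint with
  probability \<open>1 - \<epsilon>\<close> up to relative errors, so both families shrink like
  \<open>(1 - \<epsilon>)\<^sup>2\<^sup>i \<Delta>\<close>, and a relative error \<open>\<delta>\<close> grows to at most
  \<open>(1 + K \<epsilon>) \<delta>\<close>. Starting from \<open>\<epsilon>\<close> it is at most \<open>\<surd>\<epsilon>\<close> after \<open>t\<^sub>\<epsilon>\<close> rounds.
  In particular palettes always keep at least about \<open>\<surd>\<epsilon> \<Delta>\<close> colors. As an edge has
  \<open>O(\<epsilon> \<Delta>)\<close> sampled neighbours, a sampled edge fails with probability \<open>O(\<surd>\<epsilon>)\<close>, so a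
  vertex gains \<open>O(\<epsilon> \<surd>\<epsilon> \<Delta>)\<close> failed edges per round and
  \<open>O(\<surd>\<epsilon> ln (1 / \<epsilon>) \<Delta>)\<close> in total. The unsampled degree decays to
  \<open>(1 - \<epsilon>)\<^sup>t \<Delta>\<close>, about \<open>\<epsilon>\<close> to the power \<open>1 / (2 K)\<close> times \<open>\<Delta>\<close>. Both are below the claimed bound.\<close>

section \<open>Concentration on product spaces\<close>

text \<open>Palettes and color degrees must be tracked together because each drives the other: a
  color \<open>k\<close> is lost at an endpoint \<open>w\<close> when an edge from \<open>w\<close>
  to one of its color neighbors picks it, each with probability \<open>\<epsilon>\<close> divided by
  a palette size. With both families near the same \<open>p\<close>, the scale cancels and the loss
  is \<open>\<epsilon>\<close> up to a factor \<open>1 + O(\<delta>)\<close>. A fluctuation of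
  \<open>\<epsilon>^2 p\<close> per round is affordable: as
  \<open>\<epsilon> \<le> \<delta>\<close>, it is at most \<open>\<epsilon> \<delta> p\<close>, the
  order of the error that a round causes anyway. With this tolerance each tracked quantity fails
  with probability at most about \<open>exp (- \<epsilon>^4 p / 2)\<close>, and since
  \<open>p\<close> stays above \<open>sqrt \<epsilon> \<Delta>\<close>, the hypothesis in the form
  \<open>\<epsilon>^6 \<Delta> \<ge> 10^6 ln n\<close> beats all union bounds. The obstacle is that
  color degrees and failures at a vertex depend on up to about \<open>\<Delta>^2\<close> edges. For
  color degrees, a distant edge is charged only the probability of picking the single color
  \<open>k\<close>; for failures, the edges away from the vertex are fixed before its star is
  drawn.\<close>

lemma exp_le_quadratic:
  fixes x :: real
  assumes "x \<le> 1"
  shows "exp x \<le> 1 + x + x\<^sup>2"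
proof (cases "x \<ge> 0")
  case True
  then show ?thesis using exp_bound assms by blast
next
  case False
  \<comment> \<open>For negative \<open>x\<close> the product telescopes to
    \<open>1 - x ^ 3\<close>, which is at least 1; then \<open>1 - x\<close> is replaced by the
    larger \<open>exp (- x)\<close>.\<close>
  have "1 \<le> (1 + x + x\<^sup>2) * (1 - x)"
  proof -
    have "(1 + x + x\<^sup>2) * (1 - x) = 1 - x ^ 3"
      by (simp add: algebra_simps power2_eq_square power3_eq_cube)
    moreover have "x ^ 3 \<le> 0" using False by (simp add: power_le_zero_eq)
    ultimately show ?thesis by simp
  qed
  also have "\<dots> \<le> (1 + x + x\<^sup>2) * exp (- x)"
  proof (rule mult_left_mono)
    show "1 - x \<le> exp (- x)" using exp_ge_add_one_self[of "- x"] by simp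
    show "0 \<le> 1 + x + x\<^sup>2" using sum_squares_ge_zero[of "x + 1/2" 0]
      by (simp add: power2_eq_square algebra_simps)
  qed
  finally show ?thesis by (simp add: exp_minus field_simps)
qed

lemma expectation_bind_pmf_finite:
  fixes h :: "'b \<Rightarrow> real"
  assumes "finite (set_pmf p)" "\<And>x. x \<in> set_pmf p \<Longrightarrow> finite (set_pmf (f x))"
  shows "measure_pmf.expectation (bind_pmf p f) h =
    measure_pmf.expectation p (\<lambda>x. measure_pmf.expectation (f x) h)"
proof -
  have "measure_pmf.expectation (bind_pmf p f) h =
      (\<Sum>a\<in>set_pmf p. pmf p a *\<^sub>R measure_pmf.expectation (f a) h)"
    using assms by (intro pmf_expectation_bind) auto
  also have "\<dots> = measure_pmf.expectation p (\<lambda>x. measure_pmf.expectation (f x) h)"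
    using assms by (subst integral_measure_pmf[of "set_pmf p"]) auto
  finally show ?thesis .
qed

text \<open>A union bound along a chain: either the first draw leaves \<open>G\<close>, or the
  second fails from inside \<open>G\<close>. It iterates the rounds and, with \<open>G\<close> taken
  to be everything, conditions on the first draw.\<close>

lemma prob_bind_pmf_le:
  assumes "\<And>x. x \<in> set_pmf p \<Longrightarrow> x \<in> G \<Longrightarrow> measure_pmf.prob (f x) B \<le> b" "0 \<le> b"
  shows "measure_pmf.prob (bind_pmf p f) B \<le> measure_pmf.prob p (- G) + b"
proof -
  have "emeasure (bind_pmf p f) B = (\<integral>\<^sup>+x. emeasure (f x) B \<partial>p)"
    by simp
  also have "\<dots> \<le> (\<integral>\<^sup>+x. indicator (- G) x + ennreal b \<partial>p)"
  proof (rule nn_integral_mono_AE, rule AE_pmfI)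
    fix x assume x: "x \<in> set_pmf p"
    show "emeasure (f x) B \<le> indicator (- G) x + ennreal b"
    proof (cases "x \<in> G")
      case True
      then show ?thesis using assms(1)[OF x True]
        by (simp add: measure_pmf.emeasure_eq_measure ennreal_leI)
    next
      case False
      have "emeasure (f x) B \<le> 1" by (rule measure_pmf.emeasure_le_1)
      also have "\<dots> \<le> 1 + ennreal b" by simp
      finally show ?thesis using False by simp
    qed
  qed
  also have "\<dots> = emeasure p (- G) + ennreal b"
    by (subst nn_integral_add) auto
  finally have "ennreal (measure_pmf.prob (bind_pmf p f) B) \<le> ennreal (measure_pmf.prob p (- G) + b)"
    using assms(2) by (simp add: measure_pmf.emeasure_eq_measure flip: ennreal_plus)
  then show ?thesis using assms(2)
    by (metis add_nonneg_nonneg ennreal_le_iff measure_nonneg)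
qed

lemma finite_set_Pi_pmf:
  assumes "finite I" "\<And>j. j \<in> I \<Longrightarrow> finite (set_pmf (p j))"
  shows "finite (set_pmf (Pi_pmf I d p))"
  using assms by (subst set_Pi_pmf) auto

text \<open>Only the probability \<open>q\<close> of leaving the default value enters the exponent, so that a function
  of very many rarely active coordinates still concentrates well; this is what the usual bounded
  difference inequality does not give.\<close>

lemma Pi_pmf_mgf_le:
  fixes f :: "('i \<Rightarrow> 'b) \<Rightarrow> real"
  assumes "finite I"
    and "\<And>j. j \<in> I \<Longrightarrow> finite (set_pmf (p j))"
    and "\<And>j. j \<in> I \<Longrightarrow> measure_pmf.prob (p j) (R j) \<le> q j"
    and "\<And>y j. j \<in> I \<Longrightarrow> \<bar>f y - f (y(j := d))\<bar> \<le> b * indicator (R j) (y j)"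
    and "\<bar>l\<bar> * b \<le> 1" "0 \<le> b"
  shows "measure_pmf.expectation (Pi_pmf I d p) (\<lambda>y. exp (l * f y)) \<le>
    exp (l * measure_pmf.expectation (Pi_pmf I d p) f + (l * b)\<^sup>2 * sum q I)"
  using assms(1-4)
proof (induction I arbitrary: f rule: finite_induct)
  case empty
  then show ?case by simp
next
  case (insert j I)
  let ?P = "Pi_pmf I d p"
  have fin: "finite (set_pmf ?P)" using insert by (intro finite_set_Pi_pmf) auto
  have finj: "finite (set_pmf (p j))" using insert by auto
  have split: "measure_pmf.expectation (Pi_pmf (insert j I) d p) h =
      measure_pmf.expectation (p j) (\<lambda>x. measure_pmf.expectation ?P (\<lambda>y. h (y(j := x))))"
    for h :: "_ \<Rightarrow> real"
    using insert fin finj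
    by (simp add: Pi_pmf_insert' expectation_bind_pmf_finite)
  \<comment> \<open>\<open>g x\<close> is the mean of \<open>f\<close> given that coordinate
    \<open>j\<close> equals \<open>x\<close>. The induction hypothesis handles the other coordinates
    for each fixed \<open>x\<close>, which leaves a one-dimensional estimate for
    \<open>g\<close>.\<close>
  define g where "g x = measure_pmf.expectation ?P (\<lambda>y. f (y(j := x)))" for x
  define Eg where "Eg = measure_pmf.expectation (p j) g"
  have IH: "measure_pmf.expectation ?P (\<lambda>y. exp (l * f (y(j := x)))) \<le>
      exp (l * g x + (l * b)\<^sup>2 * sum q I)" for x
    unfolding g_def
  proof (rule insert.IH)
    fix y i assume i: "i \<in> I"
    then have "i \<noteq> j" using insert by auto
    then show "\<bar>f (y(j := x)) - f (y(i := d, j := x))\<bar> \<le> b * indicator (R i) (y i)"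
      using insert.prems(3)[of i "y(j := x)"] i by (simp add: fun_upd_twist[OF \<open>i \<noteq> j\<close>] del: fun_upd_apply) simp
  qed (use insert in auto)
  have gd: "\<bar>g x - g d\<bar> \<le> b * indicator (R j) x" for x
  proof -
    have "g x - g d = measure_pmf.expectation ?P (\<lambda>y. f (y(j := x)) - f (y(j := d)))"
      unfolding g_def using fin by (simp add: integrable_measure_pmf_finite)
    also have "\<bar>\<dots>\<bar> \<le> measure_pmf.expectation ?P (\<lambda>y. \<bar>f (y(j := x)) - f (y(j := d))\<bar>)"
      by (rule integral_abs_bound)
    also have "\<dots> \<le> measure_pmf.expectation ?P (\<lambda>y. b * indicator (R j) x)"
    proof (intro integral_mono integrable_measure_pmf_finite fin)
      fix y
      from insert.prems(3)[of j "y(j := x)"]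
      show "\<bar>f (y(j := x)) - f (y(j := d))\<bar> \<le> b * indicator (R j) x"
        by (simp only: fun_upd_upd fun_upd_same insertI1)
    qed
    finally show ?thesis by simp
  qed
  have int: "integrable (p j) h" for h :: "_ \<Rightarrow> real"
    using finj by (rule integrable_measure_pmf_finite)
  \<comment> \<open>Centering at \<open>g d\<close> instead of the mean makes the exponent vanish
    off \<open>R j\<close>. The quadratic term therefore carries the indicator of
    \<open>R j\<close>, whose mean is at most \<open>q j\<close>.\<close>
  have pw: "exp (l * (g x - g d)) \<le> 1 + l * (g x - g d) + (l * b)\<^sup>2 * indicator (R j) x" for x
  proof -
    have abs: "\<bar>l * (g x - g d)\<bar> \<le> \<bar>l\<bar> * b * indicator (R j) x"
      using mult_left_mono[OF gd[of x], of "\<bar>l\<bar>"] by (simp add: abs_mult mult.assoc)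
    have "\<bar>l\<bar> * b * indicator (R j) x \<le> 1" using assms(5) by (simp add: indicator_def)
    with abs have "exp (l * (g x - g d)) \<le> 1 + l * (g x - g d) + (l * (g x - g d))\<^sup>2"
      by (intro exp_le_quadratic) linarith
    moreover have "(l * (g x - g d))\<^sup>2 \<le> (\<bar>l\<bar> * b * indicator (R j) x)\<^sup>2"
      using abs by (metis abs_ge_zero power2_abs power_mono)
    ultimately show ?thesis by (cases "x \<in> R j") (auto simp: power_mult_distrib)
  qed
  have "measure_pmf.expectation (p j) (\<lambda>x. exp (l * (g x - g d))) \<le>
      measure_pmf.expectation (p j) (\<lambda>x. 1 + l * (g x - g d) + (l * b)\<^sup>2 * indicator (R j) x)"
    by (intro integral_mono int pw)
  also have "\<dots> = 1 + l * (Eg - g d) + (l * b)\<^sup>2 * measure_pmf.prob (p j) (R j)"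
    unfolding Eg_def using int by simp
  also have "\<dots> \<le> 1 + (l * (Eg - g d) + (l * b)\<^sup>2 * q j)"
    using insert.prems(2)[of j] by (simp add: mult_left_mono)
  also have "\<dots> \<le> exp (l * (Eg - g d) + (l * b)\<^sup>2 * q j)"
    by (rule exp_ge_add_one_self)
  finally have one: "measure_pmf.expectation (p j) (\<lambda>x. exp (l * (g x - g d))) \<le>
     exp (l * (Eg - g d) + (l * b)\<^sup>2 * q j)" .
  have "measure_pmf.expectation (Pi_pmf (insert j I) d p) (\<lambda>y. exp (l * f y)) \<le>
      measure_pmf.expectation (p j) (\<lambda>x. exp (l * g x + (l * b)\<^sup>2 * sum q I))"
    unfolding split by (intro integral_mono int IH)
  also have "\<dots> = measure_pmf.expectation (p j)
      (\<lambda>x. exp (l * g d + (l * b)\<^sup>2 * sum q I) * exp (l * (g x - g d)))"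
    by (simp add: exp_add[symmetric] algebra_simps)
  also have "\<dots> \<le> exp (l * g d + (l * b)\<^sup>2 * sum q I) * exp (l * (Eg - g d) + (l * b)\<^sup>2 * q j)"
    using one by simp
  also have "\<dots> = exp (l * Eg + (l * b)\<^sup>2 * sum q (insert j I))"
    using insert by (simp add: exp_add[symmetric] algebra_simps)
  also have "Eg = measure_pmf.expectation (Pi_pmf (insert j I) d p) f"
    unfolding split Eg_def g_def ..
  finally show ?case .
qed

text \<open>Markov's inequality for \<open>exp (l * f y)\<close>. The parameter \<open>l\<close>
  stays free and is chosen in each application.\<close>

lemma Pi_pmf_upper_tail:
  fixes f :: "('i \<Rightarrow> 'b) \<Rightarrow> real"
  assumes "finite I"
    and "\<And>j. j \<in> I \<Longrightarrow> finite (set_pmf (p j))"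
    and "\<And>j. j \<in> I \<Longrightarrow> measure_pmf.prob (p j) (R j) \<le> q j"
    and "\<And>y j. j \<in> I \<Longrightarrow> \<bar>f y - f (y(j := d))\<bar> \<le> b * indicator (R j) (y j)"
    and "l * b \<le> 1" "0 \<le> b" "0 < l"
  shows "measure_pmf.prob (Pi_pmf I d p) {y. f y > measure_pmf.expectation (Pi_pmf I d p) f + s} \<le>
    exp (- l * s + (l * b)\<^sup>2 * sum q I)"
proof -
  let ?P = "Pi_pmf I d p"
  let ?E = "measure_pmf.expectation ?P f"
  have fin: "finite (set_pmf ?P)" using assms by (intro finite_set_Pi_pmf) auto
  have int: "integrable ?P h" for h :: "_ \<Rightarrow> real"
    using fin by (rule integrable_measure_pmf_finite)
  have "measure_pmf.prob ?P {y. f y > ?E + s} = measure_pmf.expectation ?P (indicator {y. f y > ?E + s})"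
    by simp
  also have "\<dots> \<le> measure_pmf.expectation ?P (\<lambda>y. exp (- l * (?E + s)) * exp (l * f y))"
  proof (intro integral_mono int)
    fix y
    show "indicator {y. f y > ?E + s} y \<le> exp (- l * (?E + s)) * exp (l * f y)"
    proof (cases "f y > ?E + s")
      case True
      then have "l * (?E + s) \<le> l * f y" using assms(7) by simp
      then have "1 \<le> exp (- l * (?E + s) + l * f y)" by simp
      then show ?thesis using True by (simp only: exp_add) simp
    qed simp
  qed
  also have "\<dots> = exp (- l * (?E + s)) * measure_pmf.expectation ?P (\<lambda>y. exp (l * f y))"
    by simp
  also have "\<dots> \<le> exp (- l * (?E + s)) * exp (l * ?E + (l * b)\<^sup>2 * sum q I)"
    using assms by (intro mult_left_mono Pi_pmf_mgf_le[where R = R]) auto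
  also have "\<dots> = exp (- l * s + (l * b)\<^sup>2 * sum q I)"
    by (simp add: exp_add[symmetric] algebra_simps)
  finally show ?thesis .
qed

lemma Pi_pmf_two_sided_tail:
  fixes f :: "('i \<Rightarrow> 'b) \<Rightarrow> real"
  assumes "finite I"
    and "\<And>j. j \<in> I \<Longrightarrow> finite (set_pmf (p j))"
    and "\<And>j. j \<in> I \<Longrightarrow> measure_pmf.prob (p j) (R j) \<le> q j"
    and "\<And>y j. j \<in> I \<Longrightarrow> \<bar>f y - f (y(j := d))\<bar> \<le> b * indicator (R j) (y j)"
    and "l * b \<le> 1" "0 \<le> b" "0 < l"
  shows "measure_pmf.prob (Pi_pmf I d p) {y. \<bar>f y - measure_pmf.expectation (Pi_pmf I d p) f\<bar> > s} \<le>
    2 * exp (- l * s + (l * b)\<^sup>2 * sum q I)"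
proof -
  let ?P = "Pi_pmf I d p"
  let ?E = "measure_pmf.expectation ?P"
  have "{y. \<bar>f y - ?E f\<bar> > s} \<subseteq> {y. f y > ?E f + s} \<union> {y. - f y > ?E (\<lambda>y. - f y) + s}"
    by auto
  then have "measure_pmf.prob ?P {y. \<bar>f y - ?E f\<bar> > s} \<le>
     measure_pmf.prob ?P ({y. f y > ?E f + s} \<union> {y. - f y > ?E (\<lambda>y. - f y) + s})"
    by (intro measure_pmf.finite_measure_mono) auto
  also have "\<dots> \<le> measure_pmf.prob ?P {y. f y > ?E f + s} +
      measure_pmf.prob ?P {y. - f y > ?E (\<lambda>y. - f y) + s}"
    by (intro measure_Un_le) auto
  also have "measure_pmf.prob ?P {y. f y > ?E f + s} \<le> exp (- l * s + (l * b)\<^sup>2 * sum q I)"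
    using assms by (rule Pi_pmf_upper_tail)
  also have "measure_pmf.prob ?P {y. - f y > ?E (\<lambda>y. - f y) + s} \<le> exp (- l * s + (l * b)\<^sup>2 * sum q I)"
  proof (rule Pi_pmf_upper_tail[where R = R])
    fix y j assume "j \<in> I"
    from assms(4)[OF this, of y]
    show "\<bar>- f y - - f (y(j := d))\<bar> \<le> b * indicator (R j) (y j)" by linarith
  qed (use assms in auto)
  finally show ?thesis by simp
qed

section \<open>A round as a product of independent edge outcomes\<close>

definition edge_pmf :: "real \<Rightarrow> nat set \<Rightarrow> nat option option pmf" where
  "edge_pmf \<epsilon> P = bind_pmf (bernoulli_pmf \<epsilon>)
     (\<lambda>b. if b then map_pmf Some (pick_color P) else return_pmf None)"

text \<open>An outcome of a round maps an edge to \<^term>\<open>None\<close> if it is not sampled, and to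
  \<^term>\<open>Some c\<close> with its tentative color \<open>c\<close> if it is.\<close>

definition round_outcome ::
    "'a set set \<Rightarrow> real \<Rightarrow> real \<Rightarrow> 'a nibble_state \<Rightarrow> ('a set \<Rightarrow> nat option option) pmf" where
  "round_outcome E \<Delta> \<epsilon> st = Pi_pmf (unsampled st) None (\<lambda>e. edge_pmf \<epsilon> (palette E \<Delta> \<epsilon> st e))"

definition outcome_sample :: "'a nibble_state \<Rightarrow> ('a set \<Rightarrow> nat option option) \<Rightarrow> 'a set set" where
  "outcome_sample st y = {e \<in> unsampled st. y e \<noteq> None}"

definition apply_outcome ::
    "'a set set \<Rightarrow> 'a nibble_state \<Rightarrow> ('a set \<Rightarrow> nat option option) \<Rightarrow> 'a nibble_state" where
  "apply_outcome E st y = (let S = outcome_sample st y in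
     \<lparr>unsampled = unsampled st - S,
      sampled = sampled st \<union> S,
      tentative = (\<lambda>e. if e \<in> S then the (y e) else tentative st e),
      failed = failed st \<union> failed_edges E S (\<lambda>e. the (y e))\<rparr>)"

text \<open>The algorithm draws the whole sample before any color, but both draws are independent
  across edges. Merging them edge by edge makes the round a single product measure, to which the
  tail bounds apply.\<close>

lemma nibble_round_eq_map_outcome:
  assumes fin: "finite (unsampled st)"
  shows "nibble_round E \<Delta> \<epsilon> st = map_pmf (apply_outcome E st) (round_outcome E \<Delta> \<epsilon> st)"
proof -
  let ?U = "unsampled st"
  let ?q = "\<lambda>e. pick_color (palette E \<Delta> \<epsilon> st e)"
  let ?B = "Pi_pmf ?U False (\<lambda>_. bernoulli_pmf \<epsilon>)"
  let ?res = "\<lambda>S c. \<lparr>unsampled = unsampled st - S,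
        sampled = sampled st \<union> S,
        tentative = (\<lambda>e. if e \<in> S then c e else tentative st e),
        failed = failed st \<union> failed_edges E S c\<rparr>"
  \<comment> \<open>Mapping \<open>Some\<close> over the product sends the default
    \<open>None\<close> to \<open>Some None\<close>, which would mean sampled with color null; the
    default is swapped back to \<open>None\<close>, not sampled.\<close>
  have lift: "Pi_pmf ?U None (\<lambda>e. if b e then map_pmf Some (?q e) else return_pmf None) =
     map_pmf (\<lambda>c e. if e \<in> {e\<in>?U. b e} then Some (c e) else None) (Pi_pmf {e\<in>?U. b e} None ?q)" for b
  proof -
    let ?S = "{e\<in>?U. b e}"
    have "Pi_pmf ?U None (\<lambda>e. if b e then map_pmf Some (?q e) else return_pmf None) =
      Pi_pmf ?S None (\<lambda>e. map_pmf Some (?q e))"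
      using fin by (rule Pi_pmf_if_set)
    also have "\<dots> = map_pmf (\<lambda>f e. if e \<in> ?S then f e else None)
        (Pi_pmf ?S (Some None) (\<lambda>e. map_pmf Some (?q e)))"
      using fin by (intro Pi_pmf_default_swap[symmetric]) auto
    also have "Pi_pmf ?S (Some None) (\<lambda>e. map_pmf Some (?q e)) = map_pmf ((\<circ>) Some) (Pi_pmf ?S None ?q)"
      using fin by (subst Pi_pmf_map[where dflt = None]) auto
    finally show ?thesis by (simp add: pmf.map_comp o_def cong: if_cong)
  qed
  have res: "apply_outcome E st (\<lambda>e. if e \<in> S then Some (c e) else None) = ?res S c"
    if "S \<subseteq> ?U" for S c
  proof -
    have S: "outcome_sample st (\<lambda>e. if e \<in> S then Some (c e) else None) = S"
      using that by (auto simp: outcome_sample_def)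
    have "failed_edges E S (\<lambda>e. the (if e \<in> S then Some (c e) else None)) = failed_edges E S c"
      by (auto simp: failed_edges_def)
    then show ?thesis unfolding apply_outcome_def S Let_def by (auto simp: fun_eq_iff)
  qed
  have "round_outcome E \<Delta> \<epsilon> st = bind_pmf ?B (\<lambda>b. Pi_pmf ?U None
      (\<lambda>e. if b e then map_pmf Some (?q e) else return_pmf None))"
    unfolding round_outcome_def edge_pmf_def using fin by (rule Pi_pmf_bind)
  then have "map_pmf (apply_outcome E st) (round_outcome E \<Delta> \<epsilon> st) =
     bind_pmf ?B (\<lambda>b. map_pmf (?res {e\<in>?U. b e}) (Pi_pmf {e\<in>?U. b e} None ?q))"
    unfolding lift using res[of "{e \<in> ?U. b e}" for b]
    by (simp only: map_bind_pmf pmf.map_comp o_def Collect_subset)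
  also have "\<dots> = nibble_round E \<Delta> \<epsilon> st"
    unfolding nibble_round_def sample_edges_def by (simp add: map_pmf_def bind_assoc_pmf bind_return_pmf)
  finally show ?thesis by simp
qed

lemma finite_set_edge_pmf:
  assumes "finite P"
  shows "finite (set_pmf (edge_pmf \<epsilon> P))"
  using assms by (auto simp: edge_pmf_def pick_color_def)

lemma prob_edge_pmf:
  assumes "0 \<le> \<epsilon>" "\<epsilon> \<le> 1"
  shows "measure_pmf.prob (edge_pmf \<epsilon> P) A =
    \<epsilon> * measure_pmf.prob (pick_color P) (Some -` A) + (1 - \<epsilon>) * indicator A None"
proof -
  let ?f = "\<lambda>b. if b then map_pmf Some (pick_color P) else return_pmf None"
  have "measure_pmf.prob (edge_pmf \<epsilon> P) A =
      measure_pmf.expectation (bernoulli_pmf \<epsilon>) (\<lambda>b. measure_pmf.prob (?f b) A)"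
    unfolding edge_pmf_def measure_pmf_bind
    by (rule measure_pmf.measure_bind[where N = "count_space UNIV"])
       (auto simp del: if_split intro!: measure_pmf_in_subprob_algebra)
  then show ?thesis using assms by (simp add: measure_return_pmf)
qed

lemma prob_edge_pmf_sampled:
  assumes "0 \<le> \<epsilon>" "\<epsilon> \<le> 1"
  shows "measure_pmf.prob (edge_pmf \<epsilon> P) (- {None}) = \<epsilon>"
    and "measure_pmf.prob (edge_pmf \<epsilon> P) {None} = 1 - \<epsilon>"
  using assms by (auto simp: prob_edge_pmf vimage_def)

lemma prob_edge_pmf_color:
  assumes "0 \<le> \<epsilon>" "\<epsilon> \<le> 1" "finite P" "P \<noteq> {}"
  shows "measure_pmf.prob (edge_pmf \<epsilon> P) {Some (Some k)} = (if k \<in> P then \<epsilon> / card P else 0)"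
proof -
  have "measure_pmf.prob (pick_color P) {Some k} = pmf (map_pmf Some (pmf_of_set P)) (Some k)"
    using assms by (simp add: pick_color_def measure_pmf_single)
  also have "\<dots> = pmf (pmf_of_set P) k" by (rule pmf_map_inj') auto
  also have "\<dots> = (if k \<in> P then 1 / card P else 0)" using assms by simp
  finally have "measure_pmf.prob (pick_color P) {Some k} = (if k \<in> P then 1 / card P else 0)" .
  moreover have "Some -` {Some (Some k)} = {Some k}" by auto
  ultimately show ?thesis using assms by (simp add: prob_edge_pmf)
qed

text \<open>A nonempty palette rules out \<open>Some None\<close>, so under the invariant every
  failure is a color conflict.\<close>

lemma set_edge_pmf_subset:
  assumes "finite P" "P \<noteq> {}"
  shows "set_pmf (edge_pmf \<epsilon> P) \<subseteq> insert None ((\<lambda>k. Some (Some k)) ` P)"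
  using assms by (auto simp: edge_pmf_def pick_color_def split: if_splits)

section \<open>Survival probabilities of colors\<close>

lemma prob_Pi_pmf_ball:
  assumes "finite I" "T \<subseteq> I"
  shows "measure_pmf.prob (Pi_pmf I d p) {y. \<forall>j\<in>T. y j \<in> B j} = (\<Prod>j\<in>T. measure_pmf.prob (p j) (B j))"
proof -
  have "{y. \<forall>j\<in>T. y j \<in> B j} = Pi I (\<lambda>j. if j \<in> T then B j else UNIV)"
    using assms by (auto simp: Pi_def)
  then have "measure_pmf.prob (Pi_pmf I d p) {y. \<forall>j\<in>T. y j \<in> B j} =
      (\<Prod>j\<in>I. measure_pmf.prob (p j) (if j \<in> T then B j else UNIV))"
    using assms by (simp add: measure_Pi_pmf_Pi)
  also have "\<dots> = (\<Prod>j\<in>I. if j \<in> T then measure_pmf.prob (p j) (B j) else 1)"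
    by (intro prod.cong) auto
  also have "\<dots> = (\<Prod>j\<in>T. measure_pmf.prob (p j) (B j))"
    using assms by (simp add: prod.If_cases Int_absorb1)
  finally show ?thesis .
qed

text \<open>Weierstrass product inequality. With the upper bound below it determines the probability
  that independent edges all avoid a color, up to the square of the sum.\<close>

lemma one_minus_sum_le_prod:
  fixes q :: "'i \<Rightarrow> real"
  assumes "finite T" "\<And>j. j \<in> T \<Longrightarrow> 0 \<le> q j \<and> q j \<le> 1"
  shows "1 - sum q T \<le> (\<Prod>j\<in>T. 1 - q j)"
  using assms
proof (induction T rule: finite_induct)
  case (insert j T)
  have "1 - sum q (insert j T) \<le> (1 - q j) * (1 - sum q T)"
    using insert sum_nonneg[of T q] by (simp add: algebra_simps)
  also have "\<dots> \<le> (1 - q j) * (\<Prod>j\<in>T. 1 - q j)"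
    using insert by (intro mult_left_mono) auto
  finally show ?case using insert by simp
qed simp

lemma prod_le_one_minus_sum:
  fixes q :: "'i \<Rightarrow> real"
  assumes "finite T" "\<And>j. j \<in> T \<Longrightarrow> 0 \<le> q j \<and> q j \<le> 1"
  shows "(\<Prod>j\<in>T. 1 - q j) \<le> 1 - sum q T + (sum q T)\<^sup>2"
proof -
  have "(\<Prod>j\<in>T. 1 - q j) \<le> (\<Prod>j\<in>T. exp (- q j))"
    using assms exp_ge_add_one_self[of "- q _"] by (intro prod_mono) auto
  also have "\<dots> = exp (- sum q T)" using assms by (simp add: exp_sum sum_negf[symmetric])
  also have "\<dots> \<le> 1 - sum q T + (sum q T)\<^sup>2"
    using exp_le_quadratic[of "- sum q T"] assms sum_nonneg[of T q] by force
  finally show ?thesis .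
qed

definition color_range :: "real \<Rightarrow> real \<Rightarrow> nat set" where
  "color_range \<Delta> \<epsilon> = {k. 1 \<le> k \<and> real k \<le> (1 + \<epsilon>\<^sup>2) * \<Delta>}"

text \<open>Tentative colors of failed edges count as used, in agreement with
  \<open>palette\<close>.\<close>

definition color_used :: "'a nibble_state \<Rightarrow> 'a \<Rightarrow> nat \<Rightarrow> bool" where
  "color_used st w k \<longleftrightarrow> (\<exists>e\<in>sampled st. w \<in> e \<and> tentative st e = Some k)"

text \<open>The degree of color \<open>k\<close> at \<open>u\<close>. Whether \<open>k\<close> is used at \<open>u\<close> itself is deliberately ignored:
  otherwise the degree would drop to 0 as soon as \<open>k\<close> is used at \<open>u\<close>, and would not concentrate.\<close>

definition color_nbrs :: "'a nibble_state \<Rightarrow> 'a \<Rightarrow> nat \<Rightarrow> 'a set" where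
  "color_nbrs st u k = {w. {u, w} \<in> unsampled st \<and> \<not> color_used st w k}"

lemma finite_color_range: "finite (color_range \<Delta> \<epsilon>)"
proof (rule finite_subset)
  show "color_range \<Delta> \<epsilon> \<subseteq> {..nat \<lfloor>(1 + \<epsilon>\<^sup>2) * \<Delta>\<rfloor>}"
    by (auto simp: color_range_def le_nat_floor)
qed simp

text \<open>What is known when a round starts, with \<open>p\<close> the common scale and
  \<open>\<delta>\<close> the relative error. \<open>8 / \<epsilon> \<le> p\<close> makes the
  influence of a single edge negligible, \<open>sqrt \<epsilon> * \<Delta> \<le> p\<close> controls
  variances and failures, and \<open>2 * \<Delta>\<close> is a crude degree bound good for all
  rounds.\<close>

locale nibble_step =
  fixes V :: "'a set" and E :: "'a set set" and \<Delta> \<epsilon> :: real and st :: "'a nibble_state"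
    and p \<delta> :: real
  assumes graph: "simple_graph V E"
    and partition: "unsampled st \<union> sampled st = E" "unsampled st \<inter> sampled st = {}"
    and palette_ge: "\<And>e. e \<in> unsampled st \<Longrightarrow> (1 - \<delta>) * p \<le> real (card (palette E \<Delta> \<epsilon> st e))"
    and palette_le: "\<And>e. e \<in> unsampled st \<Longrightarrow> real (card (palette E \<Delta> \<epsilon> st e)) \<le> (1 + \<delta>) * p"
    and color_nbrs_ge: "\<And>u k. u \<in> V \<Longrightarrow> k \<in> color_range \<Delta> \<epsilon> \<Longrightarrow> (1 - \<delta>) * p \<le> real (card (color_nbrs st u k))"
    and color_nbrs_le: "\<And>u k. u \<in> V \<Longrightarrow> k \<in> color_range \<Delta> \<epsilon> \<Longrightarrow> real (card (color_nbrs st u k)) \<le> (1 + \<delta>) * p"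
    and degree_le: "\<And>v. v \<in> V \<Longrightarrow> real (vertex_degree (unsampled st) v) \<le> 2 * \<Delta>"
    and eps: "0 < \<epsilon>" "\<epsilon> \<le> 1 / 10000" and delta: "\<epsilon> \<le> \<delta>" "\<delta> \<le> 1 / 100"
    and p_ge: "sqrt \<epsilon> * \<Delta> \<le> p" "8 / \<epsilon> \<le> p" and p_le: "p \<le> \<Delta>"
begin

section \<open>Edges and palettes in a fixed state\<close>

abbreviation "U \<equiv> unsampled st"
abbreviation "P \<equiv> palette E \<Delta> \<epsilon> st"
abbreviation "Y \<equiv> round_outcome E \<Delta> \<epsilon> st"

definition U_at :: "'a \<Rightarrow> 'a set set" where "U_at v = {e \<in> U. v \<in> e}"

definition color_prob :: "'a set \<Rightarrow> nat \<Rightarrow> real" where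
  "color_prob e k = (if k \<in> P e then \<epsilon> / card (P e) else 0)"

lemma p_pos: "0 < p"
  using p_ge(2) eps by (meson divide_pos_pos less_le_trans zero_less_numeral)

lemma finite_V: "finite V" using graph by (simp add: simple_graph_def)

lemma U_subset: "U \<subseteq> E" using partition by auto

lemma finite_E: "finite E"
  using graph finite_subset[of E "Pow V"] by (auto simp: simple_graph_def)

lemma finite_U: "finite U" using U_subset finite_E finite_subset by blast

lemma finite_U_at: "finite (U_at v)" using finite_U by (simp add: U_at_def)

lemma U_at_subset: "U_at v \<subseteq> U" by (auto simp: U_at_def)

lemma edge_endpoint:
  assumes "e \<in> U" "w \<in> e"
  obtains x where "e = {w, x}" "x \<noteq> w" "x \<in> V"
proof -
  have "card e = 2" "e \<subseteq> V" using assms U_subset graph by (auto simp: simple_graph_def)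
  then obtain a b where "e = {a, b}" "a \<noteq> b" by (auto simp: card_2_iff)
  then show ?thesis using assms \<open>e \<subseteq> V\<close> that by (cases "w = a") (auto simp: doubleton_eq_iff)
qed

lemma edge_ends:
  assumes "e \<in> U"
  obtains u v where "e = {u, v}" "u \<noteq> v" "u \<in> V" "v \<in> V"
proof -
  have "card e = 2" "e \<subseteq> V" using assms U_subset graph by (auto simp: simple_graph_def)
  then show ?thesis using that by (auto simp: card_2_iff)
qed

lemma edge_distinct: "{u, w} \<in> U \<Longrightarrow> u \<noteq> w \<and> u \<in> V \<and> w \<in> V"
  by (erule edge_ends) (auto simp: doubleton_eq_iff)

lemma color_nbrs_subset: "color_nbrs st u k \<subseteq> V"
  using edge_distinct by (auto simp: color_nbrs_def)

lemma finite_color_nbrs: "finite (color_nbrs st u k)"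
  using color_nbrs_subset finite_V finite_subset by blast

text \<open>An unsampled edge differs from every sampled one, so being blocked by an adjacent
  sampled edge splits into being used at one of the two endpoints. This links palettes to color
  degrees.\<close>

lemma palette_iff:
  assumes "e \<in> U"
  shows "k \<in> P e \<longleftrightarrow> k \<in> color_range \<Delta> \<epsilon> \<and> (\<forall>w\<in>e. \<not> color_used st w k)"
proof -
  have "e \<noteq> e'" "e' \<in> E" if "e' \<in> sampled st" for e' using that assms partition by auto
  then show ?thesis
    unfolding palette_def color_range_def color_used_def adjacent_edges_def by blast
qed

lemma finite_palette: "finite (P e)"
  using finite_color_range by (auto simp: palette_def color_range_def)

lemma card_palette_pos:
  assumes "e \<in> U"
  shows "0 < card (P e)" "P e \<noteq> {}"
proof -
  have "0 < (1 - \<delta>) * p" using p_pos delta by simp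
  then have "0 < real (card (P e))" using palette_ge[OF assms] by linarith
  then show "0 < card (P e)" by simp
  then show "P e \<noteq> {}" by auto
qed

lemma prob_color:
  assumes "e \<in> U"
  shows "measure_pmf.prob (edge_pmf \<epsilon> (P e)) {Some (Some k)} = color_prob e k"
  using eps finite_palette card_palette_pos(2)[OF assms]
  by (simp add: prob_edge_pmf_color color_prob_def)

section \<open>The probability that a color is picked at a vertex\<close>

lemma color_prob_nonneg: "0 \<le> color_prob e k"
  using eps by (simp add: color_prob_def)

lemma color_prob_le:
  assumes "e \<in> U"
  shows "color_prob e k \<le> \<epsilon> / ((1 - \<delta>) * p)"
proof -
  have "0 < (1 - \<delta>) * p" using p_pos delta by simp
  then have "\<epsilon> / card (P e) \<le> \<epsilon> / ((1 - \<delta>) * p)"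
    using palette_ge[OF assms] eps by (intro divide_left_mono) auto
  moreover have "0 \<le> \<epsilon> / ((1 - \<delta>) * p)" using \<open>0 < (1 - \<delta>) * p\<close> eps by simp
  ultimately show ?thesis by (simp add: color_prob_def)
qed

lemma color_prob_small:
  assumes "e \<in> U"
  shows "color_prob e k \<le> \<epsilon> * \<delta> / 4" "color_prob e k \<le> 1"
proof -
  have "4 / \<delta> \<le> 4 / \<epsilon>" using delta eps by (intro divide_left_mono) auto
  also have "\<dots> \<le> (99 / 100) * (8 / \<epsilon>)" using eps by (simp add: field_simps)
  also have "\<dots> \<le> (1 - \<delta>) * p" using p_ge(2) eps delta by (intro mult_mono) auto
  finally have "4 / \<delta> \<le> (1 - \<delta>) * p" .
  then have "\<epsilon> / ((1 - \<delta>) * p) \<le> \<epsilon> / (4 / \<delta>)"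
    using eps delta p_pos by (intro divide_left_mono) auto
  also have "\<dots> = \<epsilon> * \<delta> / 4" by simp
  finally show 1: "color_prob e k \<le> \<epsilon> * \<delta> / 4" using color_prob_le[OF assms, of k] by linarith
  have "\<epsilon> * \<delta> \<le> 1 * 1" using eps delta by (intro mult_mono) auto
  then show "color_prob e k \<le> 1" using 1 by linarith
qed

lemma sum_color_prob:
  "(\<Sum>e\<in>U_at w. color_prob e k) = (\<Sum>e\<in>{e \<in> U_at w. k \<in> P e}. \<epsilon> / card (P e))"
  unfolding color_prob_def by (rule sum.inter_filter[symmetric]) (rule finite_U_at)

lemma card_edges_with_color:
  assumes "k \<in> color_range \<Delta> \<epsilon>" "\<not> color_used st w k"
  shows "card {e \<in> U_at w. k \<in> P e} = card (color_nbrs st w k)"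
proof -
  have "{e \<in> U_at w. k \<in> P e} = (\<lambda>x. {w, x}) ` color_nbrs st w k"
  proof (intro equalityI subsetI)
    fix e assume "e \<in> {e \<in> U_at w. k \<in> P e}"
    then have e: "e \<in> U" "w \<in> e" "k \<in> P e" by (auto simp: U_at_def)
    obtain x where "e = {w, x}" by (rule edge_endpoint[OF e(1,2)])
    then show "e \<in> (\<lambda>x. {w, x}) ` color_nbrs st w k"
      using e palette_iff[OF e(1)] by (auto simp: color_nbrs_def)
  qed (auto simp: color_nbrs_def U_at_def palette_iff assms)
  moreover have "inj_on (\<lambda>x. {w, x}) (color_nbrs st w k)"
    by (auto simp: inj_on_def doubleton_eq_iff)
  ultimately show ?thesis by (simp add: card_image)
qed

text \<open>At most \<open>(1 + \<delta>) * p\<close> edges can pick \<open>k\<close>, each with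
  probability at most \<open>\<epsilon> / ((1 - \<delta>) * p)\<close>. The cancellation of
  \<open>p\<close> is why one scale serves both families.\<close>

lemma sum_color_prob_le:
  assumes "w \<in> V" "k \<in> color_range \<Delta> \<epsilon>"
  shows "(\<Sum>e\<in>U_at w. color_prob e k) \<le> \<epsilon> * (1 + 3 * \<delta>)"
proof (cases "color_used st w k")
  case True
  then have "color_prob e k = 0" if "e \<in> U_at w" for e
    using that palette_iff[of e k] by (auto simp: color_prob_def U_at_def)
  then have "(\<Sum>e\<in>U_at w. color_prob e k) = 0" by simp
  then show ?thesis using eps delta by simp
next
  case False
  have pos: "0 < (1 - \<delta>) * p" using p_pos delta by simp
  have "(\<Sum>e\<in>U_at w. color_prob e k) \<le>
      real (card {e \<in> U_at w. k \<in> P e}) * (\<epsilon> / ((1 - \<delta>) * p))"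
    unfolding sum_color_prob
  proof (rule sum_bounded_above)
    fix e assume "e \<in> {e \<in> U_at w. k \<in> P e}"
    then show "\<epsilon> / real (card (P e)) \<le> \<epsilon> / ((1 - \<delta>) * p)"
      using color_prob_le[of e k] by (auto simp: color_prob_def U_at_def)
  qed
  also have "\<dots> \<le> ((1 + \<delta>) * p) * (\<epsilon> / ((1 - \<delta>) * p))"
    using color_nbrs_le[OF assms] pos eps unfolding card_edges_with_color[OF assms(2) False]
    by (intro mult_right_mono) auto
  also have "\<dots> = \<epsilon> * ((1 + \<delta>) / (1 - \<delta>))" using p_pos by simp
  also have "\<dots> \<le> \<epsilon> * (1 + 3 * \<delta>)"
  proof (intro mult_left_mono)
    have "\<delta> * \<delta> \<le> \<delta> * (1/100)" using delta eps by (intro mult_left_mono) auto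
    then have "1 + \<delta> \<le> (1 + 3 * \<delta>) * (1 - \<delta>)" using delta eps by (simp add: algebra_simps)
    then show "(1 + \<delta>) / (1 - \<delta>) \<le> 1 + 3 * \<delta>" using delta by (simp add: pos_divide_le_eq)
  qed (use eps in simp)
  finally show ?thesis .
qed

lemma sum_color_prob_ge:
  assumes "w \<in> V" "k \<in> color_range \<Delta> \<epsilon>" "\<not> color_used st w k"
  shows "\<epsilon> * (1 - 2 * \<delta>) \<le> (\<Sum>e\<in>U_at w. color_prob e k)"
proof -
  have "(1 - 2 * \<delta>) * (1 + \<delta>) \<le> 1 - \<delta>" using delta eps by (simp add: algebra_simps)
  then have "1 - 2 * \<delta> \<le> (1 - \<delta>) / (1 + \<delta>)" using delta eps by (subst pos_le_divide_eq) auto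
  then have "\<epsilon> * (1 - 2 * \<delta>) \<le> \<epsilon> * ((1 - \<delta>) / (1 + \<delta>))"
    using eps by (intro mult_left_mono) auto
  also have "\<dots> = ((1 - \<delta>) * p) * (\<epsilon> / ((1 + \<delta>) * p))" using p_pos delta eps by simp
  also have "\<dots> \<le> real (card {e \<in> U_at w. k \<in> P e}) * (\<epsilon> / ((1 + \<delta>) * p))"
    using color_nbrs_ge[OF assms(1,2)] p_pos delta eps unfolding card_edges_with_color[OF assms(2,3)]
    by (intro mult_right_mono) auto
  also have "\<dots> \<le> (\<Sum>e\<in>U_at w. color_prob e k)"
    unfolding sum_color_prob
  proof (rule sum_bounded_below)
    fix e assume "e \<in> {e \<in> U_at w. k \<in> P e}"
    then have "e \<in> U" by (auto simp: U_at_def)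
    then show "\<epsilon> / ((1 + \<delta>) * p) \<le> \<epsilon> / real (card (P e))"
      using palette_le[of e] card_palette_pos[of e] eps delta p_pos
      by (intro divide_left_mono) auto
  qed
  finally show ?thesis .
qed

lemma prob_avoid_bounds:
  assumes "T \<subseteq> U" "s = (\<Sum>e\<in>T. color_prob e k)"
  shows "1 - s \<le> (\<Prod>e\<in>T. 1 - color_prob e k)" "(\<Prod>e\<in>T. 1 - color_prob e k) \<le> 1 - s + s\<^sup>2"
  using assms finite_subset[OF assms(1) finite_U] color_prob_nonneg color_prob_small(2)
  by (auto intro!: one_minus_sum_le_prod prod_le_one_minus_sum)

lemma prob_avoid_edge:
  assumes "e \<in> U"
  shows "measure_pmf.prob (edge_pmf \<epsilon> (P e)) (- {Some (Some k)}) = 1 - color_prob e k"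
  using measure_pmf.prob_compl[of "{Some (Some k)}" "edge_pmf \<epsilon> (P e)"] prob_color[OF assms, of k]
  by (simp add: Compl_eq_Diff_UNIV)

text \<open>Defined for every outcome, even one that samples \<open>e\<close>, so that its size is a
  function of the independent coordinates alone. It is the actual next palette when \<open>e\<close>
  stays unsampled (\<open>palette_apply\<close>).\<close>

definition new_palette :: "'a set \<Rightarrow> ('a set \<Rightarrow> nat option option) \<Rightarrow> nat set" where
  "new_palette e y = {k \<in> P e. \<forall>e'\<in>{e'\<in>U. e' \<noteq> e \<and> e' \<inter> e \<noteq> {}}. y e' \<noteq> Some (Some k)}"

definition new_color_nbrs :: "'a \<Rightarrow> nat \<Rightarrow> ('a set \<Rightarrow> nat option option) \<Rightarrow> 'a set" where
  "new_color_nbrs u k y = {w \<in> color_nbrs st u k. y {u, w} = None \<and> (\<forall>e\<in>U_at w. y e \<noteq> Some (Some k))}"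

text \<open>The edges of \<open>T\<close> avoid \<open>k\<close> independently, and each endpoint
  contributes about \<open>\<epsilon>\<close> to \<open>s\<close>. So the product is
  \<open>1 - 2 * \<epsilon>\<close> up to \<open>O(\<epsilon> \<delta>)\<close>; squares of
  \<open>\<epsilon>\<close> are absorbed through \<open>\<epsilon> \<le> \<delta>\<close>.\<close>

lemma prob_palette_survival:
  assumes e: "e \<in> U" and k: "k \<in> P e"
  shows "\<bar>measure_pmf.prob Y {y. k \<in> new_palette e y} - (1 - \<epsilon>)\<^sup>2\<bar> \<le> 10 * (\<epsilon> * \<delta>)"
proof -
  define T where "T = {e'\<in>U. e' \<noteq> e \<and> e' \<inter> e \<noteq> {}}"
  define s where "s = (\<Sum>e\<in>T. color_prob e k)"
  have T: "T \<subseteq> U" by (auto simp: T_def)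
  obtain u v where uv: "e = {u, v}" "u \<noteq> v" "u \<in> V" "v \<in> V" by (rule edge_ends[OF e])
  have k': "k \<in> color_range \<Delta> \<epsilon>" "\<not> color_used st u k" "\<not> color_used st v k"
    using k palette_iff[OF e] uv by auto
  have ev: "{y. k \<in> new_palette e y} = {y. \<forall>e\<in>T. y e \<in> - {Some (Some k)}}"
    using k by (auto simp: new_palette_def T_def)
  have prob: "measure_pmf.prob Y {y. k \<in> new_palette e y} = (\<Prod>e\<in>T. 1 - color_prob e k)"
    unfolding ev round_outcome_def prob_Pi_pmf_ball[OF finite_U T]
    by (intro prod.cong refl prob_avoid_edge subsetD[OF T])
  have "U_at u \<inter> U_at v = {e}"
  proof -
    have "e' = e" if "e' \<in> U_at u" "e' \<in> U_at v" for e'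
      using that uv edge_endpoint[of e' u] by (auto simp: U_at_def)
    then show ?thesis using uv e by (auto simp: U_at_def)
  qed
  moreover have "U_at u \<union> U_at v = insert e T" "e \<notin> T"
    using uv e by (auto simp: U_at_def T_def)
  \<comment> \<open>\<open>e\<close> is counted at both ends but does not belong to
    \<open>T\<close>, hence the correction by twice its probability.\<close>
  ultimately have "(\<Sum>e\<in>U_at u. color_prob e k) + (\<Sum>e\<in>U_at v. color_prob e k) = s + 2 * color_prob e k"
    using sum.union_inter[OF finite_U_at finite_U_at, of "\<lambda>e. color_prob e k" u v]
      finite_subset[OF T finite_U] by (simp add: s_def)
  then have "2 * (\<epsilon> * (1 - 2 * \<delta>)) - \<epsilon> * \<delta> / 2 \<le> s" "s \<le> 2 * (\<epsilon> * (1 + 3 * \<delta>))"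
    using sum_color_prob_ge[OF uv(3) k'(1,2)] sum_color_prob_ge[OF uv(4) k'(1,3)]
      sum_color_prob_le[OF uv(3) k'(1)] sum_color_prob_le[OF uv(4) k'(1)]
      color_prob_small(1)[OF e, of k] color_prob_nonneg[of e k] by linarith+
  then have s: "2 * \<epsilon> - 9/2 * (\<epsilon> * \<delta>) \<le> s" "s \<le> 2 * \<epsilon> + 6 * (\<epsilon> * \<delta>)"
    by (simp_all add: algebra_simps)
  have "\<epsilon> * \<delta> \<le> \<epsilon> * (1/100)" using delta eps by (intro mult_left_mono) auto
  then have s0: "0 \<le> s" "s \<le> 21/10 * \<epsilon>" using s eps by linarith+
  have "s\<^sup>2 \<le> (21/10 * \<epsilon>)\<^sup>2" using s0 by (intro power_mono) auto
  then have "s\<^sup>2 \<le> 441/100 * \<epsilon>\<^sup>2" by (simp add: power_mult_distrib power_divide)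
  then have s2: "s\<^sup>2 \<le> 45/10 * \<epsilon>\<^sup>2" using zero_le_power2[of \<epsilon>] by linarith
  have sq: "(1 - \<epsilon>)\<^sup>2 = 1 - 2 * \<epsilon> + \<epsilon>\<^sup>2" by (simp add: power2_diff)
  have "\<epsilon>\<^sup>2 \<le> \<epsilon> * \<delta>" "0 \<le> \<epsilon>\<^sup>2" using eps delta by (auto simp: power2_eq_square)
  then show ?thesis
    using prob_avoid_bounds[OF T s_def] s s2 sq unfolding prob by linarith
qed

text \<open>Here one factor \<open>1 - \<epsilon>\<close> is exact, the edge \<open>{u, w}\<close>
  staying unsampled; the other is the approximate probability that the remaining edges at
  \<open>w\<close> avoid \<open>k\<close>.\<close>

lemma prob_color_nbr_survival:
  assumes u: "u \<in> V" and k: "k \<in> color_range \<Delta> \<epsilon>" and w: "w \<in> color_nbrs st u k"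
  shows "\<bar>measure_pmf.prob Y {y. w \<in> new_color_nbrs u k y} - (1 - \<epsilon>)\<^sup>2\<bar> \<le> 10 * (\<epsilon> * \<delta>)"
proof -
  define T where "T = U_at w - {{u, w}}"
  define s where "s = (\<Sum>e\<in>T. color_prob e k)"
  have w': "{u, w} \<in> U" "\<not> color_used st w k" using w by (auto simp: color_nbrs_def)
  have wV: "w \<in> V" using edge_distinct[OF w'(1)] by simp
  have T: "T \<subseteq> U" "finite T" using U_at_subset finite_U_at by (auto simp: T_def)
  have uw: "{u, w} \<in> U_at w" "{u, w} \<notin> T" "U_at w = insert {u, w} T"
    using w' by (auto simp: U_at_def T_def)
  \<comment> \<open>Both requirements become one product event. On \<open>{u, w}\<close> the value
    \<open>None\<close> already implies that \<open>k\<close> is not picked.\<close>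
  let ?B = "\<lambda>e. if e = {u, w} then {None} else - {Some (Some k)}"
  have ev: "{y. w \<in> new_color_nbrs u k y} = {y. \<forall>e\<in>insert {u, w} T. y e \<in> ?B e}"
  proof (intro Collect_cong)
    fix y
    have ball_insert: "(\<forall>e\<in>insert a T. Q e) \<longleftrightarrow> Q a \<and> (\<forall>e\<in>T. Q e)" for a Q by blast
    have "(\<forall>e\<in>T. y e \<in> ?B e) \<longleftrightarrow> (\<forall>e\<in>T. y e \<noteq> Some (Some k))"
      using uw(2) by (intro ball_cong refl) auto
    moreover have "w \<in> new_color_nbrs u k y \<longleftrightarrow> y {u, w} = None \<and> (\<forall>e\<in>T. y e \<noteq> Some (Some k))"
    proof -
      have "w \<in> new_color_nbrs u k y \<longleftrightarrow> y {u, w} = None \<and> (\<forall>e\<in>U_at w. y e \<noteq> Some (Some k))"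
        using w by (simp add: new_color_nbrs_def)
      then show ?thesis unfolding uw(3) by auto
    qed
    ultimately show "w \<in> new_color_nbrs u k y \<longleftrightarrow> (\<forall>e\<in>insert {u, w} T. y e \<in> ?B e)"
      by (simp only: ball_insert if_True singleton_iff refl)
  qed
  have "measure_pmf.prob Y {y. w \<in> new_color_nbrs u k y} =
     (\<Prod>e\<in>insert {u, w} T. measure_pmf.prob (edge_pmf \<epsilon> (P e)) (?B e))"
    unfolding ev round_outcome_def using w' T finite_U
    by (intro prob_Pi_pmf_ball) auto
  also have "\<dots> = (1 - \<epsilon>) * (\<Prod>e\<in>T. measure_pmf.prob (edge_pmf \<epsilon> (P e)) (?B e))"
    using T uw eps by (simp add: prob_edge_pmf_sampled)
  also have "(\<Prod>e\<in>T. measure_pmf.prob (edge_pmf \<epsilon> (P e)) (?B e)) = (\<Prod>e\<in>T. 1 - color_prob e k)"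
  proof (rule prod.cong)
    fix e assume "e \<in> T"
    then have "e \<in> U" "e \<noteq> {u, w}" using T uw by auto
    then show "measure_pmf.prob (edge_pmf \<epsilon> (P e)) (?B e) = 1 - color_prob e k"
      by (simp add: prob_avoid_edge)
  qed simp
  finally have prob: "measure_pmf.prob Y {y. w \<in> new_color_nbrs u k y} =
    (1 - \<epsilon>) * (\<Prod>e\<in>T. 1 - color_prob e k)" .
  have "(\<Sum>e\<in>U_at w. color_prob e k) = color_prob {u, w} k + s"
    unfolding uw(3) s_def using T uw by simp
  then have "\<epsilon> * (1 - 2 * \<delta>) - \<epsilon> * \<delta> / 4 \<le> s" "s \<le> \<epsilon> * (1 + 3 * \<delta>)"
    using sum_color_prob_ge[OF wV k w'(2)] sum_color_prob_le[OF wV k]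
      color_prob_small(1)[OF w'(1), of k] color_prob_nonneg[of "{u, w}" k] by linarith+
  then have s: "\<epsilon> - 9/4 * (\<epsilon> * \<delta>) \<le> s" "s \<le> \<epsilon> + 3 * (\<epsilon> * \<delta>)"
    by (simp_all add: algebra_simps)
  have "\<epsilon> * \<delta> \<le> \<epsilon> * (1/100)" using delta eps by (intro mult_left_mono) auto
  then have s0: "0 \<le> s" "s \<le> 11/10 * \<epsilon>" using s eps by linarith+
  have "s\<^sup>2 \<le> (11/10 * \<epsilon>)\<^sup>2" using s0 by (intro power_mono) auto
  then have "s\<^sup>2 \<le> 121/100 * \<epsilon>\<^sup>2" by (simp add: power_mult_distrib power_divide)
  then have s2: "s\<^sup>2 \<le> 2 * \<epsilon>\<^sup>2" using zero_le_power2[of \<epsilon>] by linarith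
  have e2: "\<epsilon>\<^sup>2 \<le> \<epsilon> * \<delta>" "0 \<le> \<epsilon>\<^sup>2" using eps delta by (auto simp: power2_eq_square)
  let ?q = "\<Prod>e\<in>T. 1 - color_prob e k"
  have h1: "\<bar>?q - (1 - \<epsilon>)\<bar> \<le> 10 * (\<epsilon> * \<delta>)"
    using prob_avoid_bounds[OF T(1) s_def] s s2 e2 by linarith
  have h2: "\<bar>(1 - \<epsilon>) * ?q - (1 - \<epsilon>)\<^sup>2\<bar> = (1 - \<epsilon>) * \<bar>?q - (1 - \<epsilon>)\<bar>"
  proof -
    have "(1 - \<epsilon>) * ?q - (1 - \<epsilon>)\<^sup>2 = (1 - \<epsilon>) * (?q - (1 - \<epsilon>))"
      by (simp only: power2_eq_square right_diff_distrib)
    then show ?thesis using eps by (simp add: abs_mult)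
  qed
  have h3: "(1 - \<epsilon>) * \<bar>?q - (1 - \<epsilon>)\<bar> \<le> 1 * \<bar>?q - (1 - \<epsilon>)\<bar>"
    using eps by (intro mult_right_mono) auto
  show ?thesis unfolding prob h2 using order_trans[OF h3[unfolded mult_1] h1] .
qed

end

section \<open>Concentration of degrees, palettes and color degrees\<close>

lemma expectation_card_filter:
  assumes "finite A" "finite (set_pmf M)"
  shows "measure_pmf.expectation M (\<lambda>y. real (card {x \<in> A. Q x y})) =
    (\<Sum>x\<in>A. measure_pmf.prob M {y. Q x y})"
proof -
  have "measure_pmf.expectation M (\<lambda>y. real (card {x \<in> A. Q x y})) =
      measure_pmf.expectation M (\<lambda>y. \<Sum>x\<in>A. indicator {y. Q x y} y)"
    using assms by (simp add: indicator_def of_bool_def sum.If_cases Int_def)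
  also have "\<dots> = (\<Sum>x\<in>A. measure_pmf.expectation M (indicator {y. Q x y}))"
    using assms by (intro Bochner_Integration.integral_sum integrable_measure_pmf_finite)
  finally show ?thesis by simp
qed

lemma abs_card_diff_le:
  assumes "finite A" "finite B" "finite D" "A \<subseteq> B" "B \<subseteq> A \<union> D" "card D \<le> n"
  shows "\<bar>real (card B) - real (card A)\<bar> \<le> real n"
    and "\<bar>real (card A) - real (card B)\<bar> \<le> real n"
proof -
  have "card A \<le> card B" using assms by (intro card_mono) auto
  moreover have "card B \<le> card (A \<union> D)" using assms by (intro card_mono) auto
  moreover have "card (A \<union> D) \<le> card A + card D" by (rule card_Un_le)
  ultimately show "\<bar>real (card B) - real (card A)\<bar> \<le> real n"
    "\<bar>real (card A) - real (card B)\<bar> \<le> real n" using assms by linarith+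
qed

lemma sum_UN_le:
  fixes f :: "'b \<Rightarrow> real"
  assumes "finite N" "\<And>w. finite (A w)" "\<And>j. 0 \<le> f j"
  shows "sum f (\<Union>w\<in>N. A w) \<le> (\<Sum>w\<in>N. sum f (A w))"
  using assms(1)
proof (induction N rule: finite_induct)
  case (insert w N)
  have "sum f (A w \<union> (\<Union>w\<in>N. A w)) \<le> sum f (A w) + sum f (\<Union>w\<in>N. A w)"
    using insert.hyps(1) assms by (simp add: sum_Un sum_nonneg)
  then show ?case using insert by simp
qed simp

context nibble_step
begin

definition fluctuation_bound :: real where
  "fluctuation_bound = exp (- (\<epsilon> ^ 4 * p) / 2)"

lemma Delta_pos: "0 < \<Delta>" using p_pos p_le by linarith

lemma sqrt_eps: "0 < sqrt \<epsilon>" "sqrt \<epsilon> \<le> 1 / 100" "\<epsilon> = sqrt \<epsilon> * sqrt \<epsilon>" "100 * \<epsilon> \<le> sqrt \<epsilon>"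
proof -
  show 1: "0 < sqrt \<epsilon>" "\<epsilon> = sqrt \<epsilon> * sqrt \<epsilon>" using eps by auto
  show 2: "sqrt \<epsilon> \<le> 1 / 100" by (rule real_le_lsqrt) (use eps in \<open>auto simp: power2_eq_square\<close>)
  have "sqrt \<epsilon> * sqrt \<epsilon> \<le> sqrt \<epsilon> * (1 / 100)" using 1 2 by (intro mult_left_mono) auto
  then show "100 * \<epsilon> \<le> sqrt \<epsilon>" using 1 by linarith
qed

lemma eps_Delta_le: "100 * (\<epsilon> * \<Delta>) \<le> p"
proof -
  have "100 * \<epsilon> * \<Delta> \<le> sqrt \<epsilon> * \<Delta>" using sqrt_eps Delta_pos by (intro mult_right_mono) auto
  then show ?thesis using p_ge(1) by simp
qed

lemma finite_set_edge: "finite (set_pmf (edge_pmf \<epsilon> (P e)))"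
  using finite_palette by (rule finite_set_edge_pmf)

lemma finite_set_Y: "finite (set_pmf Y)"
  unfolding round_outcome_def using finite_U finite_set_edge by (rule finite_set_Pi_pmf)

lemma card_U_at_le: "v \<in> V \<Longrightarrow> real (card (U_at v)) \<le> 2 * \<Delta>"
  using degree_le[of v] by (simp add: U_at_def vertex_degree_def)

lemma prob_sampled: "measure_pmf.prob (edge_pmf \<epsilon> A) (- {None}) = \<epsilon>"
  using eps by (intro prob_edge_pmf_sampled) auto

text \<open>The tail bound with Lipschitz constant 2 and \<open>l = \<epsilon>^2\<close>. The
  exponent is \<open>\<epsilon> ^ 4 * (4 * sum q U - p)\<close>, and \<open>4 * sum q U\<close> is
  at most \<open>16 * (\<epsilon> * \<Delta>)\<close>, well below \<open>p / 2\<close>.\<close>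

lemma outcome_two_sided_tail:
  assumes "\<And>j. j \<in> U \<Longrightarrow> measure_pmf.prob (edge_pmf \<epsilon> (P j)) (R j) \<le> q j"
    and "\<And>y j. j \<in> U \<Longrightarrow> \<bar>f y - f (y(j := None))\<bar> \<le> 2 * indicator (R j) (y j)"
    and "sum q U \<le> 4 * (\<epsilon> * \<Delta>)"
  shows "measure_pmf.prob Y {y. \<bar>f y - measure_pmf.expectation Y f\<bar> > \<epsilon>\<^sup>2 * p} \<le> 2 * fluctuation_bound"
proof -
  have "\<epsilon> * \<epsilon> \<le> \<epsilon> * 1" using eps by (intro mult_left_mono) auto
  then have "\<epsilon>\<^sup>2 \<le> 1 / 10000" using eps unfolding power2_eq_square by linarith
  then have "measure_pmf.prob Y {y. \<bar>f y - measure_pmf.expectation Y f\<bar> > \<epsilon>\<^sup>2 * p} \<le>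
      2 * exp (- \<epsilon>\<^sup>2 * (\<epsilon>\<^sup>2 * p) + (\<epsilon>\<^sup>2 * 2)\<^sup>2 * sum q U)"
    unfolding round_outcome_def using finite_U finite_set_edge eps assms(1,2)
    by (intro Pi_pmf_two_sided_tail[where R = R]) auto
  also have "- \<epsilon>\<^sup>2 * (\<epsilon>\<^sup>2 * p) + (\<epsilon>\<^sup>2 * 2)\<^sup>2 * sum q U = \<epsilon> ^ 4 * (4 * sum q U - p)"
    by (simp add: power4_eq_xxxx power2_eq_square algebra_simps)
  also have "\<dots> \<le> \<epsilon> ^ 4 * (- p / 2)"
  proof (rule mult_left_mono)
    show "4 * sum q U - p \<le> - p / 2" using assms(3) eps_Delta_le p_pos by linarith
  qed simp
  finally show ?thesis by (simp add: fluctuation_bound_def)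
qed

lemma sum_eps_indicator:
  assumes "A \<subseteq> U"
  shows "(\<Sum>j\<in>U. if j \<in> A then \<epsilon> else 0) = \<epsilon> * card A"
  using finite_U assms by (simp add: sum.If_cases Int_absorb1)

definition sampled_at :: "'a \<Rightarrow> ('a set \<Rightarrow> nat option option) \<Rightarrow> 'a set set" where
  "sampled_at v y = {e \<in> U_at v. y e \<noteq> None}"

lemma sampled_at_tail:
  assumes "v \<in> V"
  shows "measure_pmf.prob Y {y. \<bar>real (card (sampled_at v y)) - \<epsilon> * real (card (U_at v))\<bar> > \<epsilon>\<^sup>2 * p}
    \<le> 2 * fluctuation_bound"
proof -
  have one: "measure_pmf.prob Y {y. y e \<noteq> None} = \<epsilon>" if "e \<in> U_at v" for e
  proof -
    have ev: "{y. y e \<noteq> None} = {y. \<forall>j\<in>{e}. y j \<in> - {None}}" by auto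
    have "{e} \<subseteq> U" using that U_at_subset by auto
    then show ?thesis
      unfolding round_outcome_def ev prob_Pi_pmf_ball[OF finite_U \<open>{e} \<subseteq> U\<close>] by (simp add: prob_sampled)
  qed
  have E: "measure_pmf.expectation Y (\<lambda>y. real (card (sampled_at v y))) = \<epsilon> * real (card (U_at v))"
    unfolding sampled_at_def using finite_U_at finite_set_Y by (simp add: expectation_card_filter one del: not_None_eq)
  show ?thesis unfolding E[symmetric]
  proof (rule outcome_two_sided_tail)
    let ?R = "\<lambda>j. if j \<in> U_at v then - {None} else {}"
    let ?q = "\<lambda>j. if j \<in> U_at v then \<epsilon> else 0"
    show "measure_pmf.prob (edge_pmf \<epsilon> (P j)) (?R j) \<le> ?q j" for j
      by (simp add: prob_sampled)
    show "sum ?q U \<le> 4 * (\<epsilon> * \<Delta>)"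
      using card_U_at_le[OF assms] eps Delta_pos unfolding sum_eps_indicator[OF U_at_subset]
      by simp
    fix y j
    show "\<bar>real (card (sampled_at v y)) - real (card (sampled_at v (y(j := None))))\<bar> \<le>
        2 * indicator (?R j) (y j)"
    proof (cases "j \<in> U_at v \<and> y j \<noteq> None")
      case True
      have "\<bar>real (card (sampled_at v y)) - real (card (sampled_at v (y(j := None))))\<bar> \<le> real 2"
        by (rule abs_card_diff_le[where D = "{j}"]) (auto simp: sampled_at_def finite_U_at)
      then show ?thesis using True by simp
    next
      case False
      then have "sampled_at v (y(j := None)) = sampled_at v y" by (auto simp: sampled_at_def)
      then show ?thesis by simp
    qed
  qed
qed

lemma new_palette_tail:
  assumes e: "e \<in> U"
  shows "measure_pmf.prob Y {y. \<bar>real (card (new_palette e y)) -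
      measure_pmf.expectation Y (\<lambda>y. real (card (new_palette e y)))\<bar> > \<epsilon>\<^sup>2 * p}
    \<le> 2 * fluctuation_bound"
proof (rule outcome_two_sided_tail)
  define T where "T = {e' \<in> U. e' \<noteq> e \<and> e' \<inter> e \<noteq> {}}"
  let ?R = "\<lambda>j. if j \<in> T then - {None} else {}"
  let ?q = "\<lambda>j. if j \<in> T then \<epsilon> else 0"
  show "measure_pmf.prob (edge_pmf \<epsilon> (P j)) (?R j) \<le> ?q j" for j
    by (simp add: prob_sampled)
  obtain u v where uv: "e = {u, v}" "u \<in> V" "v \<in> V" using edge_ends[OF e] by metis
  have "T \<subseteq> U_at u \<union> U_at v" using uv by (auto simp: T_def U_at_def)
  then have "card T \<le> card (U_at u \<union> U_at v)"
    using finite_U_at by (intro card_mono) auto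
  also have "\<dots> \<le> card (U_at u) + card (U_at v)" by (rule card_Un_le)
  finally have "real (card T) \<le> 4 * \<Delta>"
    using card_U_at_le[OF uv(2)] card_U_at_le[OF uv(3)] by linarith
  moreover have "T \<subseteq> U" by (auto simp: T_def)
  ultimately show "sum ?q U \<le> 4 * (\<epsilon> * \<Delta>)" using eps by (simp add: sum_eps_indicator)
  fix y j
  show "\<bar>real (card (new_palette e y)) - real (card (new_palette e (y(j := None))))\<bar> \<le>
      2 * indicator (?R j) (y j)"
  proof (cases "j \<in> T \<and> y j \<noteq> None")
    case True
    \<comment> \<open>An edge carries one color and so removes at most one from the palette; 2 is
      only the common constant of the tail bound.\<close>
    let ?D = "{k. y j = Some (Some k)}"
    have "?D \<subseteq> {the (the (y j))}" by auto
    then have D: "finite ?D" "card ?D \<le> 2"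
      using finite_subset[of ?D "{the (the (y j))}"] card_mono[of "{the (the (y j))}" ?D] by auto
    have "\<bar>real (card (new_palette e y)) - real (card (new_palette e (y(j := None))))\<bar> \<le> real 2"
      by (rule abs_card_diff_le[where D = ?D]) (auto simp: new_palette_def finite_palette D)
    then show ?thesis using True by simp
  next
    case False
    have "new_palette e (y(j := None)) = new_palette e y"
    proof (cases "y j = None")
      case True
      then have "y(j := None) = y" by auto
      then show ?thesis by simp
    next
      case nN: False
      then have "j \<notin> T" using False by simp
      then show ?thesis unfolding new_palette_def T_def[symmetric] by auto
    qed
    then show ?thesis by simp
  qed
qed

lemma finite_new_color_nbrs: "finite (new_color_nbrs u k y)"
  using finite_color_nbrs by (simp add: new_color_nbrs_def)

text \<open>Edges at \<open>u\<close> matter once they are sampled. An edge away from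
  \<open>u\<close> that meets the color neighborhood matters only if it picks \<open>k\<close>; by
  \<open>sum_color_prob_le\<close> all of these together contribute about
  \<open>\<epsilon> * \<Delta>\<close> to the sum of the \<open>?q\<close>, however many there
  are.\<close>

lemma new_color_nbrs_tail:
  assumes u: "u \<in> V" and k: "k \<in> color_range \<Delta> \<epsilon>"
  shows "measure_pmf.prob Y {y. \<bar>real (card (new_color_nbrs u k y)) -
      measure_pmf.expectation Y (\<lambda>y. real (card (new_color_nbrs u k y)))\<bar> > \<epsilon>\<^sup>2 * p}
    \<le> 2 * fluctuation_bound"
proof (rule outcome_two_sided_tail)
  let ?N = "color_nbrs st u k"
  let ?R = "\<lambda>j. if u \<in> j then - {None} else if j \<inter> ?N \<noteq> {} then {Some (Some k)} else {}"
  let ?q = "\<lambda>j. if u \<in> j then \<epsilon> else if j \<inter> ?N \<noteq> {} then color_prob j k else 0"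
  show "measure_pmf.prob (edge_pmf \<epsilon> (P j)) (?R j) \<le> ?q j" if "j \<in> U" for j
    using prob_color[OF that] by (simp add: prob_sampled)
  define W where "W = (\<Union>w\<in>?N. U_at w)"
  have W: "W \<subseteq> U" using U_at_subset by (auto simp: W_def)
  have "sum ?q U \<le> (\<Sum>j\<in>U. (if j \<in> U_at u then \<epsilon> else 0) + (if j \<in> W then color_prob j k else 0))"
    using eps color_prob_nonneg by (intro sum_mono) (auto simp: U_at_def W_def)
  also have "\<dots> = \<epsilon> * card (U_at u) + (\<Sum>j\<in>W. color_prob j k)"
    using U_at_subset finite_U W by (simp add: sum.distrib sum_eps_indicator sum.If_cases Int_absorb1)
  also have "(\<Sum>j\<in>W. color_prob j k) \<le> (\<Sum>w\<in>?N. \<Sum>j\<in>U_at w. color_prob j k)"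
    unfolding W_def using finite_color_nbrs finite_U_at color_prob_nonneg by (intro sum_UN_le) auto
  also have "\<dots> \<le> real (card ?N) * (\<epsilon> * (1 + 3 * \<delta>))"
    using color_nbrs_subset k by (intro sum_bounded_above sum_color_prob_le) auto
  also have "\<dots> \<le> ((1 + 1 / 100) * \<Delta>) * (\<epsilon> * (1 + 3 / 100))"
  proof (intro mult_mono)
    have "(1 + \<delta>) * p \<le> (1 + 1 / 100) * \<Delta>" using delta eps p_le p_pos by (intro mult_mono) auto
    then show "real (card ?N) \<le> (1 + 1 / 100) * \<Delta>" using color_nbrs_le[OF u k] by linarith
  qed (use delta eps Delta_pos in auto)
  finally have "sum ?q U \<le> \<epsilon> * real (card (U_at u)) + ((1 + 1 / 100) * \<Delta>) * (\<epsilon> * (1 + 3 / 100))" by simp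
  moreover have "\<epsilon> * real (card (U_at u)) \<le> \<epsilon> * (2 * \<Delta>)"
    using card_U_at_le[OF u] eps by (intro mult_left_mono) auto
  moreover have "0 < \<epsilon> * \<Delta>" using eps Delta_pos by simp
  ultimately show "sum ?q U \<le> 4 * (\<epsilon> * \<Delta>)" by (simp add: algebra_simps)
  fix y j assume j: "j \<in> U"
  show "\<bar>real (card (new_color_nbrs u k y)) - real (card (new_color_nbrs u k (y(j := None))))\<bar> \<le>
      2 * indicator (?R j) (y j)"
  proof (cases "y j \<in> ?R j")
    case True
    \<comment> \<open>Only the endpoints of \<open>j\<close> can join or leave the set when the
      outcome of \<open>j\<close> changes.\<close>
    have "finite j" "card j \<le> 2" using edge_ends[OF j] by (metis finite.emptyI finite.insertI card_2_iff order_refl)+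
    then have "\<bar>real (card (new_color_nbrs u k y)) - real (card (new_color_nbrs u k (y(j := None))))\<bar> \<le> real 2"
      by (intro abs_card_diff_le(2)[where D = j] finite_new_color_nbrs)
        (auto simp: new_color_nbrs_def U_at_def split: if_splits)
    then show ?thesis using True by simp
  next
    case False
    have "new_color_nbrs u k (y(j := None)) = new_color_nbrs u k y"
    proof (cases "y j = None")
      case True
      then have "y(j := None) = y" by auto
      then show ?thesis by simp
    next
      case nN: False
      then have "u \<notin> j" "j \<inter> ?N = {} \<or> y j \<noteq> Some (Some k)" using False by (auto split: if_splits)
      then show ?thesis by (auto simp: new_color_nbrs_def U_at_def)
    qed
    then show ?thesis by simp
  qed
qed

end

section \<open>Failures at a vertex\<close>

context nibble_step
begin

text \<open>The partner \<open>e'\<close> may range over all of \<open>U\<close>: the outcome of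
  \<open>e\<close> is not \<open>None\<close>, so equal outcomes force \<open>e'\<close> to be
  sampled too.\<close>

definition failed_at :: "'a \<Rightarrow> ('a set \<Rightarrow> nat option option) \<Rightarrow> 'a set set" where
  "failed_at v y = {e \<in> sampled_at v y. y e = Some None \<or> (\<exists>e'\<in>U. e' \<noteq> e \<and> e \<inter> e' \<noteq> {} \<and> y e' = y e)}"

lemma finite_failed_at: "finite (failed_at v y)"
  using finite_U_at by (simp add: failed_at_def sampled_at_def)

text \<open>Erasing an outcome removes a possible conflict partner and never creates one. This
  supplies the inclusion that the Lipschitz bound needs.\<close>

lemma failed_at_mono: "failed_at v (y(j := None)) \<subseteq> failed_at v y"
proof
  let ?y = "y(j := None)"
  fix e assume e: "e \<in> failed_at v ?y"
  then have "e \<noteq> j" "e \<in> sampled_at v ?y" by (auto simp: failed_at_def sampled_at_def)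
  then have e': "?y e = y e" "e \<in> sampled_at v y" "y e \<noteq> None" by (simp_all add: sampled_at_def)
  show "e \<in> failed_at v y"
  proof (cases "y e = Some None")
    case True
    then show ?thesis using e' by (simp add: failed_at_def)
  next
    case False
    then obtain f where f: "f \<in> U" "f \<noteq> e" "e \<inter> f \<noteq> {}" "?y f = ?y e"
      using e unfolding failed_at_def mem_Collect_eq e'(1) by blast
    then have "f \<noteq> j" using e' by (metis fun_upd_same)
    then have "y f = y e" using f e' by simp
    then show ?thesis unfolding failed_at_def mem_Collect_eq using f e' by blast
  qed
qed

text \<open>If two edges at \<open>v\<close> besides \<open>j\<close> carry the color of \<open>j\<close>, they already conflict with each
  other; so \<open>j\<close> decides about at most one further failure at \<open>v\<close>.\<close>

lemma failed_at_lipschitz: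
  "\<bar>real (card (failed_at v y)) - real (card (failed_at v (y(j := None))))\<bar> \<le> 2"
proof -
  let ?y = "y(j := None)"
  define X where "X = failed_at v y - failed_at v ?y - {j}"
  have key: "e \<in> U_at v \<and> e \<noteq> j \<and> y e \<noteq> None \<and> y e = y j \<and> \<not> (\<exists>e'\<in>U. e' \<noteq> e \<and> e \<inter> e' \<noteq> {} \<and> ?y e' = y e)"
    if "e \<in> X" for e
  proof -
    have X: "e \<noteq> j" "e \<in> failed_at v y" "e \<notin> failed_at v ?y"
      using that by (simp_all add: X_def)
    then have e: "e \<in> U_at v" "e \<noteq> j" "y e \<noteq> None" "e \<in> failed_at v y" "e \<notin> failed_at v ?y"
      by (simp_all add: failed_at_def[of v y] sampled_at_def)
    then have n: "y e \<noteq> Some None" and m: "\<not> (\<exists>e'\<in>U. e' \<noteq> e \<and> e \<inter> e' \<noteq> {} \<and> ?y e' = y e)"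
      by (simp_all add: failed_at_def sampled_at_def)
    obtain e' where e': "e' \<in> U" "e' \<noteq> e" "e \<inter> e' \<noteq> {}" "y e' = y e"
      using e(4) n by (auto simp: failed_at_def)
    have "e' = j"
    proof (rule ccontr)
      assume "e' \<noteq> j"
      then have "?y e' = y e" using e'(4) by (simp only: fun_upd_other[OF \<open>e' \<noteq> j\<close>])
      then show False using m e' by blast
    qed
    then have "y e = y j" using e'(4) by metis
    then show ?thesis using e(1-3) m by (intro conjI)
  qed
  have "e1 = e2" if "e1 \<in> X" "e2 \<in> X" for e1 e2
  proof (rule ccontr)
    assume "e1 \<noteq> e2"
    have "e1 \<in> U_at v" "e2 \<in> U_at v" using key that by blast+
    then have "e2 \<in> U" "e1 \<inter> e2 \<noteq> {}" by (auto simp: U_at_def)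
    moreover have "y e1 = y j" "y e2 = y j" "e2 \<noteq> j" using key that by blast+
    then have "?y e2 = y e1" by simp
    ultimately show False using key[OF that(1)] \<open>e1 \<noteq> e2\<close> by blast
  qed
  moreover have X: "finite X" using finite_failed_at by (simp add: X_def)
  ultimately have "card X \<le> 1" by (simp add: card_le_Suc0_iff_eq)
  \<comment> \<open>The second unit is \<open>j\<close> itself, which may fail only when it is
    sampled.\<close>
  then have "card (insert j X) \<le> 2" using X by (simp add: card_insert_if)
  then have "\<bar>real (card (failed_at v y)) - real (card (failed_at v ?y))\<bar> \<le> real 2"
    using X by (intro abs_card_diff_le[where D = "insert j X"] finite_failed_at failed_at_mono)
      (auto simp: X_def)
  then show ?thesis by simp
qed

section \<open>Conditioning on the edges away from a vertex\<close>

definition outside_outcome :: "'a \<Rightarrow> ('a set \<Rightarrow> nat option option) pmf" where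
  "outside_outcome v = Pi_pmf (U - U_at v) None (\<lambda>e. edge_pmf \<epsilon> (P e))"

definition star_outcome :: "'a \<Rightarrow> ('a set \<Rightarrow> nat option option) pmf" where
  "star_outcome v = Pi_pmf (U_at v) None (\<lambda>e. edge_pmf \<epsilon> (P e))"

definition combine ::
    "'a \<Rightarrow> ('a set \<Rightarrow> nat option option) \<Rightarrow> ('a set \<Rightarrow> nat option option) \<Rightarrow> 'a set \<Rightarrow> nat option option"
  where "combine v z g = (\<lambda>e. if e \<in> U - U_at v then z e else g e)"

text \<open>Disjoint blocks of coordinates are independent, so the star of \<open>v\<close> can be
  drawn after everything else.\<close>

lemma outcome_eq_combine:
  "Y = bind_pmf (outside_outcome v) (\<lambda>z. map_pmf (combine v z) (star_outcome v))"
proof -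
  have "Y = Pi_pmf ((U - U_at v) \<union> U_at v) None (\<lambda>e. edge_pmf \<epsilon> (P e))"
    using U_at_subset by (simp add: round_outcome_def Un_absorb2)
  also have "\<dots> = map_pmf (\<lambda>(z, g). combine v z g) (pair_pmf (outside_outcome v) (star_outcome v))"
    unfolding outside_outcome_def star_outcome_def combine_def using finite_U finite_U_at
    by (intro Pi_pmf_union) auto
  finally show ?thesis by (simp add: pair_pmf_def map_pmf_def bind_assoc_pmf bind_return_pmf)
qed

lemma finite_set_star_outcome: "finite (set_pmf (star_outcome v))"
  unfolding star_outcome_def using finite_U_at finite_set_edge by (rule finite_set_Pi_pmf)

lemma prob_star_color:
  assumes "e \<in> U_at v"
  shows "measure_pmf.prob (star_outcome v) {g. g e = Some (Some k)} = color_prob e k"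
proof -
  have ev: "{g. g e = Some (Some k)} = {g. \<forall>j\<in>{e}. g j \<in> {Some (Some k)}}" by auto
  have sub: "{e} \<subseteq> U_at v" "e \<in> U" using assms U_at_subset by auto
  show ?thesis unfolding star_outcome_def ev prob_Pi_pmf_ball[OF finite_U_at sub(1)]
    by (simp add: prob_color sub)
qed

lemma prob_star_two_colors:
  assumes "e \<in> U_at v" "e' \<in> U_at v" "e \<noteq> e'"
  shows "measure_pmf.prob (star_outcome v) {g. g e = Some (Some k) \<and> g e' = Some (Some k)} =
    color_prob e k * color_prob e' k"
proof -
  have ev: "{g. g e = Some (Some k) \<and> g e' = Some (Some k)} = {g. \<forall>j\<in>{e, e'}. g j \<in> {Some (Some k)}}"
    by auto
  have sub: "{e, e'} \<subseteq> U_at v" "e \<in> U" "e' \<in> U" using assms U_at_subset by auto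
  show ?thesis unfolding star_outcome_def ev prob_Pi_pmf_ball[OF finite_U_at sub(1)]
    using assms(3) by (simp add: prob_color sub)
qed

lemma star_outcome_support:
  assumes "e \<in> U_at v" "g \<in> set_pmf (star_outcome v)"
  shows "g e = None \<or> (\<exists>k\<in>P e. g e = Some (Some k))"
proof -
  have "g e \<in> set_pmf (edge_pmf \<epsilon> (P e))"
    using assms finite_U_at by (auto simp: star_outcome_def set_Pi_pmf PiE_dflt_def)
  then show ?thesis
    using set_edge_pmf_subset[OF finite_palette card_palette_pos(2)] assms(1) U_at_subset by blast
qed

text \<open>Union over the color of \<open>e\<close>: these probabilities sum to
  \<open>\<epsilon>\<close>, and given each of them \<open>e'\<close> matches with probability at
  most \<open>\<epsilon> / ((1 - \<delta>) * p)\<close>.\<close>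

lemma prob_star_collision_le:
  assumes e: "e \<in> U_at v" and e': "e' \<in> U_at v" "e \<noteq> e'"
  shows "measure_pmf.prob (star_outcome v) {g. g e \<noteq> None \<and> g e' = g e} \<le> \<epsilon> * (\<epsilon> / ((1 - \<delta>) * p))"
proof -
  let ?M = "measure_pmf.prob (star_outcome v)"
  have U: "e \<in> U" "e' \<in> U" using assms U_at_subset by auto
  have "?M {g. g e \<noteq> None \<and> g e' = g e} =
      ?M ({g. g e \<noteq> None \<and> g e' = g e} \<inter> set_pmf (star_outcome v))"
    by (simp add: measure_Int_set_pmf)
  also have "\<dots> \<le> ?M (\<Union>k\<in>P e. {g. g e = Some (Some k) \<and> g e' = Some (Some k)})"
    using star_outcome_support[OF e] by (intro measure_pmf.finite_measure_mono) fastforce+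
  also have "\<dots> \<le> (\<Sum>k\<in>P e. ?M {g. g e = Some (Some k) \<and> g e' = Some (Some k)})"
    using finite_palette by (intro measure_pmf.finite_measure_subadditive_finite) auto
  also have "\<dots> = (\<Sum>k\<in>P e. color_prob e k * color_prob e' k)"
    using prob_star_two_colors[OF e e'] by simp
  also have "\<dots> \<le> (\<Sum>k\<in>P e. color_prob e k * (\<epsilon> / ((1 - \<delta>) * p)))"
    using color_prob_le[OF U(2)] color_prob_nonneg by (intro sum_mono mult_left_mono) auto
  also have "\<dots> = \<epsilon> * (\<epsilon> / ((1 - \<delta>) * p))"
    using card_palette_pos[OF U(1)] by (simp add: color_prob_def)
  finally show ?thesis .
qed

text \<open>With \<open>e = {v, w}\<close>, a conflict at \<open>w\<close> means hitting one of at
  most \<open>3 * (\<epsilon> * \<Delta>)\<close> colors fixed by \<open>z\<close>, and a conflict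
  at \<open>v\<close> is a collision with one of at most \<open>2 * \<Delta>\<close> star edges;
  together the factor is 5.\<close>

lemma prob_star_failed_le:
  assumes v: "v \<in> V" and e: "e \<in> U_at v"
    and z: "\<And>w. w \<in> V \<Longrightarrow> real (card {e \<in> U_at w - U_at v. z e \<noteq> None}) \<le> 3 * (\<epsilon> * \<Delta>)"
  shows "measure_pmf.prob (star_outcome v) {g. e \<in> failed_at v (combine v z g)} \<le>
    5 * (\<epsilon> * \<Delta>) * (\<epsilon> / ((1 - \<delta>) * p))"
proof -
  let ?M = "measure_pmf.prob (star_outcome v)"
  let ?m = "\<epsilon> / ((1 - \<delta>) * p)"
  have eU: "e \<in> U" "v \<in> e" using e by (auto simp: U_at_def)
  obtain w where w: "e = {v, w}" "w \<noteq> v" "w \<in> V" by (rule edge_endpoint[OF eU])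
  have m: "0 \<le> ?m" using eps delta p_pos by simp
  define S where "S = {e \<in> U_at w - U_at v. z e \<noteq> None}"
  \<comment> \<open>The colors that the fixed outcome blocks at \<open>w\<close>; once
    \<open>z\<close> is known this set is deterministic.\<close>
  define B where "B = {k. \<exists>e\<in>S. z e = Some (Some k)}"
  have S: "finite S" using finite_U_at by (simp add: S_def)
  have "B \<subseteq> (\<lambda>e. the (the (z e))) ` S" by (force simp: B_def)
  then have B: "finite B" "card B \<le> card S"
    using S finite_surj surj_card_le by blast+
  then have cB: "real (card B) \<le> 3 * (\<epsilon> * \<Delta>)" using z[OF w(3)] by (simp add: S_def)
  have "?M {g. e \<in> failed_at v (combine v z g)} =
      ?M ({g. e \<in> failed_at v (combine v z g)} \<inter> set_pmf (star_outcome v))"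
    by (simp add: measure_Int_set_pmf)
  also have "\<dots> \<le> ?M ((\<Union>k\<in>B. {g. g e = Some (Some k)}) \<union> (\<Union>e'\<in>U_at v - {e}. {g. g e \<noteq> None \<and> g e' = g e}))"
  proof (rule measure_pmf.finite_measure_mono)
    show "{g. e \<in> failed_at v (combine v z g)} \<inter> set_pmf (star_outcome v) \<subseteq>
       (\<Union>k\<in>B. {g. g e = Some (Some k)}) \<union> (\<Union>e'\<in>U_at v - {e}. {g. g e \<noteq> None \<and> g e' = g e})"
    proof
      fix g assume g: "g \<in> {g. e \<in> failed_at v (combine v z g)} \<inter> set_pmf (star_outcome v)"
      have ce: "combine v z g e = g e" using e by (simp add: combine_def)
      then have "g e \<noteq> None" using g by (auto simp: failed_at_def sampled_at_def)
      then obtain k where k: "g e = Some (Some k)" using star_outcome_support[OF e, of g] g by auto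
      then obtain e' where e': "e' \<in> U" "e' \<noteq> e" "e \<inter> e' \<noteq> {}" "combine v z g e' = Some (Some k)"
        using g ce by (auto simp: failed_at_def)
      show "g \<in> (\<Union>k\<in>B. {g. g e = Some (Some k)}) \<union> (\<Union>e'\<in>U_at v - {e}. {g. g e \<noteq> None \<and> g e' = g e})"
      proof (cases "e' \<in> U_at v")
        case True
        then have "g e' = g e" using e' k by (simp add: combine_def)
        then show ?thesis using True e'(2) \<open>g e \<noteq> None\<close> by blast
      next
        case False
        then have "z e' = Some (Some k)" using e' by (simp add: combine_def)
        \<comment> \<open>\<open>e'\<close> meets \<open>{v, w}\<close> but does not contain
          \<open>v\<close>.\<close>
        moreover have "e' \<in> U_at w" using e' False w by (auto simp: U_at_def)
        ultimately have "k \<in> B" using False by (auto simp: B_def S_def)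
        then show ?thesis using k by blast
      qed
    qed
  qed simp
  also have "\<dots> \<le> ?M (\<Union>k\<in>B. {g. g e = Some (Some k)}) + ?M (\<Union>e'\<in>U_at v - {e}. {g. g e \<noteq> None \<and> g e' = g e})"
    by (intro measure_Un_le) auto
  also have "?M (\<Union>k\<in>B. {g. g e = Some (Some k)}) \<le> (\<Sum>k\<in>B. ?M {g. g e = Some (Some k)})"
    using B by (intro measure_pmf.finite_measure_subadditive_finite) auto
  also have "\<dots> \<le> real (card B) * ?m"
    using color_prob_le[OF eU(1)] prob_star_color[OF e] by (intro sum_bounded_above) simp
  also have "\<dots> \<le> 3 * (\<epsilon> * \<Delta>) * ?m" using cB m by (intro mult_right_mono) auto
  also have "?M (\<Union>e'\<in>U_at v - {e}. {g. g e \<noteq> None \<and> g e' = g e}) \<le>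
      (\<Sum>e'\<in>U_at v - {e}. ?M {g. g e \<noteq> None \<and> g e' = g e})"
    using finite_U_at by (intro measure_pmf.finite_measure_subadditive_finite) auto
  also have "\<dots> \<le> real (card (U_at v - {e})) * (\<epsilon> * ?m)"
    using prob_star_collision_le[OF e] by (intro sum_bounded_above) auto
  also have "\<dots> \<le> (2 * \<Delta>) * (\<epsilon> * ?m)"
  proof (intro mult_right_mono)
    have "card (U_at v - {e}) \<le> card (U_at v)" using finite_U_at by (intro card_mono) auto
    then show "real (card (U_at v - {e})) \<le> 2 * \<Delta>" using card_U_at_le[OF v] by linarith
  qed (use mult_nonneg_nonneg[OF less_imp_le[OF eps(1)] m] in simp)
  finally show ?thesis by (simp add: algebra_simps)
qed

text \<open>Of the 12, 11 covers the expectation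
  \<open>(2 * \<Delta>) * (5 * (\<epsilon> * \<Delta>))\<close> times
  \<open>\<epsilon> / ((1 - \<delta>) * p)\<close>, and 1 is the allowed deviation.\<close>

definition failure_bound :: real where
  "failure_bound = 12 * (\<epsilon> * sqrt \<epsilon> * \<Delta>)"

text \<open>With \<open>z\<close> fixed, the count depends on at most \<open>2 * \<Delta>\<close>
  coordinates, each active with probability \<open>\<epsilon>\<close>, and is Lipschitz with
  constant 2; the tail bound is used with \<open>l = \<epsilon>\<close>.\<close>

lemma prob_many_failures_star_le:
  assumes v: "v \<in> V"
    and z: "\<And>w. w \<in> V \<Longrightarrow> real (card {e \<in> U_at w - U_at v. z e \<noteq> None}) \<le> 3 * (\<epsilon> * \<Delta>)"
  shows "measure_pmf.prob (star_outcome v) {g. real (card (failed_at v (combine v z g))) > failure_bound}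
    \<le> fluctuation_bound"
proof -
  let ?M = "measure_pmf.prob (star_outcome v)"
  let ?m = "\<epsilon> / ((1 - \<delta>) * p)"
  let ?f = "\<lambda>g. real (card (failed_at v (combine v z g)))"
  let ?E = "measure_pmf.expectation (star_outcome v) ?f"
  let ?s = "\<epsilon> * sqrt \<epsilon> * \<Delta>"
  have m: "0 \<le> ?m" using eps delta p_pos by simp
  have sub: "failed_at v y = {e \<in> U_at v. e \<in> failed_at v y}" for y
    by (auto simp: failed_at_def sampled_at_def)
  have "?E = (\<Sum>e\<in>U_at v. ?M {g. e \<in> failed_at v (combine v z g)})"
    unfolding expectation_card_filter[OF finite_U_at finite_set_star_outcome, symmetric]
    by (rule Bochner_Integration.integral_cong[OF refl], rule arg_cong[where f = "\<lambda>X. real (card X)", OF sub])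
  also have "\<dots> \<le> real (card (U_at v)) * (5 * (\<epsilon> * \<Delta>) * ?m)"
    using prob_star_failed_le[OF v _ z] by (intro sum_bounded_above) auto
  also have "\<dots> \<le> (2 * \<Delta>) * (5 * (\<epsilon> * \<Delta>) * ?m)"
    using card_U_at_le[OF v] m eps Delta_pos
    by (intro mult_right_mono mult_nonneg_nonneg[OF _ m]) auto
  also have "\<dots> = 10 * (\<epsilon> * \<Delta>) * (\<Delta> * ?m)" by simp
  also have "\<Delta> * ?m \<le> 11 / 10 * sqrt \<epsilon>"
  proof -
    have "10 / 11 * (sqrt \<epsilon> * \<Delta>) \<le> (1 - \<delta>) * p"
      using p_ge(1) delta sqrt_eps Delta_pos by (intro mult_mono) auto
    then have "?m \<le> \<epsilon> / (10 / 11 * (sqrt \<epsilon> * \<Delta>))"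
      using eps sqrt_eps Delta_pos delta p_pos by (intro divide_left_mono) auto
    then have "\<Delta> * ?m \<le> \<Delta> * (\<epsilon> / (10 / 11 * (sqrt \<epsilon> * \<Delta>)))"
      using Delta_pos by (intro mult_left_mono) auto
    also have "\<dots> = 11 / 10 * (\<epsilon> / sqrt \<epsilon>)" using Delta_pos by simp
    also have "\<epsilon> / sqrt \<epsilon> = sqrt \<epsilon>" using eps by (simp add: real_div_sqrt)
    finally show ?thesis .
  qed
  then have "10 * (\<epsilon> * \<Delta>) * (\<Delta> * ?m) \<le> 10 * (\<epsilon> * \<Delta>) * (11 / 10 * sqrt \<epsilon>)"
    using eps Delta_pos by (intro mult_left_mono) auto
  also have "\<dots> = 11 * ?s" by simp
  finally have E: "?E \<le> 11 * ?s" .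
  have "?M {g. ?f g > failure_bound} \<le> ?M {g. ?f g > ?E + ?s}"
    using E by (intro measure_pmf.finite_measure_mono) (auto simp: failure_bound_def)
  also have "\<dots> \<le> exp (- \<epsilon> * ?s + (\<epsilon> * 2)\<^sup>2 * (\<Sum>j\<in>U_at v. \<epsilon>))"
    unfolding star_outcome_def
  proof (rule Pi_pmf_upper_tail[where R = "\<lambda>_. - {None}"])
    fix y j assume j: "j \<in> U_at v"
    have c: "combine v z (y(j := None)) = (combine v z y)(j := None)"
      using j by (auto simp: combine_def)
    show "\<bar>?f y - ?f (y(j := None))\<bar> \<le> 2 * indicator (- {None}) (y j)"
    proof (cases "y j = None")
      case True
      then have "y(j := None) = y" by auto
      then show ?thesis by simp
    next
      case False
      then show ?thesis using failed_at_lipschitz[of v "combine v z y" j] unfolding c by simp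
    qed
  qed (use finite_U_at finite_set_edge eps prob_sampled in auto)
  \<comment> \<open>The variance term \<open>8 * \<epsilon> ^ 3 * \<Delta>\<close> is at most half
    of the main term \<open>\<epsilon> * ?s\<close>, and the other half still exceeds
    \<open>\<epsilon> ^ 4 * p / 2\<close>.\<close>
  also have "\<dots> \<le> fluctuation_bound"
  proof -
    have "(\<epsilon> * 2)\<^sup>2 * (\<Sum>j\<in>U_at v. \<epsilon>) = 4 * \<epsilon> ^ 3 * real (card (U_at v))"
      by (simp add: power2_eq_square power3_eq_cube)
    also have "\<dots> \<le> 4 * \<epsilon> ^ 3 * (2 * \<Delta>)"
      using card_U_at_le[OF v] eps by (intro mult_left_mono) auto
    also have "\<dots> = 8 * \<epsilon> * (\<epsilon>\<^sup>2 * \<Delta>)" by (simp add: power2_eq_square power3_eq_cube)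
    also have "\<dots> \<le> (sqrt \<epsilon> / 2) * (\<epsilon>\<^sup>2 * \<Delta>)"
      using sqrt_eps Delta_pos by (intro mult_right_mono) auto
    finally have 1: "(\<epsilon> * 2)\<^sup>2 * (\<Sum>j\<in>U_at v. \<epsilon>) \<le> (sqrt \<epsilon> / 2) * (\<epsilon>\<^sup>2 * \<Delta>)" .
    have "\<epsilon>\<^sup>2 * p \<le> sqrt \<epsilon> * \<Delta>"
    proof (intro mult_mono)
      have "\<epsilon> * \<epsilon> \<le> \<epsilon> * 1" using eps by (intro mult_left_mono) auto
      then show "\<epsilon>\<^sup>2 \<le> sqrt \<epsilon>" using sqrt_eps(4) eps unfolding power2_eq_square by linarith
    qed (use p_le p_pos sqrt_eps in auto)
    then have "\<epsilon>\<^sup>2 * (\<epsilon>\<^sup>2 * p) \<le> \<epsilon>\<^sup>2 * (sqrt \<epsilon> * \<Delta>)" by (intro mult_left_mono) auto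
    then have 2: "\<epsilon> ^ 4 * p \<le> sqrt \<epsilon> * (\<epsilon>\<^sup>2 * \<Delta>)"
      by (simp add: power4_eq_xxxx power2_eq_square algebra_simps)
    have "\<epsilon> * ?s = sqrt \<epsilon> * (\<epsilon>\<^sup>2 * \<Delta>)" by (simp add: power2_eq_square)
    with 1 2 have "- \<epsilon> * ?s + (\<epsilon> * 2)\<^sup>2 * (\<Sum>j\<in>U_at v. \<epsilon>) \<le> - (\<epsilon> ^ 4 * p) / 2" by linarith
    then show ?thesis by (simp add: fluctuation_bound_def)
  qed
  finally show ?thesis .
qed

text \<open>The outcome on the edges not containing \<open>v\<close> is fixed first. There are too many of them for
  a bounded difference argument, but all that matters is that they block few colors at each
  neighbour of \<open>v\<close>.\<close>

lemma prob_many_failures_le: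
  assumes v: "v \<in> V"
  shows "measure_pmf.prob Y {y. (\<forall>w\<in>V. real (card (sampled_at w y)) \<le> 3 * (\<epsilon> * \<Delta>)) \<and>
      real (card (failed_at v y)) > failure_bound} \<le> fluctuation_bound" (is "measure_pmf.prob Y ?B \<le> _")
proof -
  have "measure_pmf.prob Y ?B \<le> measure_pmf.prob (outside_outcome v) (- UNIV) + fluctuation_bound"
    unfolding outcome_eq_combine[of v]
  proof (rule prob_bind_pmf_le)
    show "0 \<le> fluctuation_bound" by (simp add: fluctuation_bound_def)
    fix z
    show "measure_pmf.prob (map_pmf (combine v z) (star_outcome v)) ?B \<le> fluctuation_bound"
    proof (cases "\<forall>w\<in>V. real (card {e \<in> U_at w - U_at v. z e \<noteq> None}) \<le> 3 * (\<epsilon> * \<Delta>)")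
      case True
      have "measure_pmf.prob (map_pmf (combine v z) (star_outcome v)) ?B \<le>
         measure_pmf.prob (star_outcome v) {g. real (card (failed_at v (combine v z g))) > failure_bound}"
        unfolding measure_map_pmf by (intro measure_pmf.finite_measure_mono) auto
      also have "\<dots> \<le> fluctuation_bound" using True by (intro prob_many_failures_star_le v) auto
      finally show ?thesis .
    next
      case False
      \<comment> \<open>Such a \<open>z\<close> already violates the bound on sampled edges at
        \<open>w\<close>, and no completion on the star repairs it. So the event is empty.\<close>
      then obtain w where w: "w \<in> V" "real (card {e \<in> U_at w - U_at v. z e \<noteq> None}) > 3 * (\<epsilon> * \<Delta>)"
        by auto
      have "finite (sampled_at w y)" for y using finite_U_at by (simp add: sampled_at_def)
      then have "card {e \<in> U_at w - U_at v. z e \<noteq> None} \<le> card (sampled_at w (combine v z g))" for g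
        by (intro card_mono) (auto simp: sampled_at_def combine_def U_at_def)
      then have "\<not> real (card (sampled_at w (combine v z g))) \<le> 3 * (\<epsilon> * \<Delta>)" for g
        using w(2) by (meson less_le_trans not_le of_nat_mono)
      then have "combine v z -` ?B = {}" using w(1) by blast
      then show ?thesis
        by (simp only: measure_map_pmf measure_empty) (simp add: fluctuation_bound_def)
    qed
  qed
  then show ?thesis by simp
qed

end

section \<open>The invariant of a round\<close>

lemma prob_UN_le:
  assumes "finite I" "\<And>i. i \<in> I \<Longrightarrow> measure_pmf.prob M (A i) \<le> b"
  shows "measure_pmf.prob M (\<Union>i\<in>I. A i) \<le> real (card I) * b"
proof -
  have "measure_pmf.prob M (\<Union>i\<in>I. A i) \<le> (\<Sum>i\<in>I. measure_pmf.prob M (A i))"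
    using assms by (intro measure_pmf.finite_measure_subadditive_finite) auto
  also have "\<dots> \<le> real (card I) * b" using assms(2) by (rule sum_bounded_above)
  finally show ?thesis .
qed

text \<open>Where \<open>K = 48\<close> suffices: with \<open>x = \<epsilon> * \<delta> * p\<close>,
  the drift is at most \<open>20 * x\<close> and the fluctuation at most \<open>x\<close>. Since
  \<open>(1 - \<epsilon>)^2\<close> is at least one half, their sum is below 48 times
  \<open>x * (1 - \<epsilon>)^2\<close>.\<close>

lemma shrink_relative_error:
  fixes N X p \<epsilon> \<delta> :: real
  assumes N: "(1 - \<delta>) * p \<le> N" "N \<le> (1 + \<delta>) * p"
    and X: "\<bar>X - (1 - \<epsilon>)\<^sup>2 * N\<bar> \<le> 10 * (\<epsilon> * \<delta>) * N + \<epsilon>\<^sup>2 * p"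
    and eps: "0 < \<epsilon>" "\<epsilon> \<le> 1 / 10000" and delta: "\<epsilon> \<le> \<delta>" "\<delta> \<le> 1 / 100" and p: "0 < p"
  shows "(1 - (1 + 48 * \<epsilon>) * \<delta>) * ((1 - \<epsilon>)\<^sup>2 * p) \<le> X"
    and "X \<le> (1 + (1 + 48 * \<epsilon>) * \<delta>) * ((1 - \<epsilon>)\<^sup>2 * p)"
proof -
  let ?a = "(1 - \<epsilon>)\<^sup>2"
  define x where "x = \<epsilon> * \<delta> * p"
  have x: "0 < x" using eps delta p by (simp add: x_def)
  have "?a = 1 - 2 * \<epsilon> + \<epsilon>\<^sup>2" by (simp add: power2_diff)
  then have a: "1 / 2 \<le> ?a" using eps zero_le_power2[of \<epsilon>] by linarith
  have "(1 + \<delta>) * p \<le> 2 * p" using delta p by (intro mult_right_mono) auto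
  then have "10 * (\<epsilon> * \<delta>) * N \<le> 10 * (\<epsilon> * \<delta>) * (2 * p)"
    using N(2) eps delta by (intro mult_left_mono) auto
  then have 1: "10 * (\<epsilon> * \<delta>) * N \<le> 20 * x" by (simp add: x_def)
  have "\<epsilon> * \<epsilon> * p \<le> \<epsilon> * \<delta> * p"
    using eps delta p by (intro mult_right_mono mult_left_mono) auto
  then have 2: "\<epsilon>\<^sup>2 * p \<le> x" by (simp add: power2_eq_square x_def)
  have "x * (1 / 2) \<le> x * ?a" using a x by (intro mult_left_mono) auto
  then have err: "10 * (\<epsilon> * \<delta>) * N + \<epsilon>\<^sup>2 * p \<le> 48 * (x * ?a)" using 1 2 x by linarith
  have "?a * ((1 - \<delta>) * p) \<le> ?a * N" "?a * N \<le> ?a * ((1 + \<delta>) * p)"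
    using N by (auto intro!: mult_left_mono)
  then have "?a * ((1 - \<delta>) * p) - 48 * (x * ?a) \<le> X" "X \<le> ?a * ((1 + \<delta>) * p) + 48 * (x * ?a)"
    using X err by linarith+
  moreover have "(1 - (1 + 48 * \<epsilon>) * \<delta>) * (?a * p) = ?a * ((1 - \<delta>) * p) - 48 * (x * ?a)"
    unfolding x_def by algebra
  moreover have "(1 + (1 + 48 * \<epsilon>) * \<delta>) * (?a * p) = ?a * ((1 + \<delta>) * p) + 48 * (x * ?a)"
    unfolding x_def by algebra
  ultimately show "(1 - (1 + 48 * \<epsilon>) * \<delta>) * (?a * p) \<le> X" "X \<le> (1 + (1 + 48 * \<epsilon>) * \<delta>) * (?a * p)"
    by simp_all
qed

text \<open>Palettes and color degrees are bounded on both sides because their ratio governs the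
  next round; unsampled and failed degrees only need the upper bounds \<open>D\<close> and
  \<open>F\<close>.\<close>

definition nibble_inv ::
    "'a set \<Rightarrow> 'a set set \<Rightarrow> real \<Rightarrow> real \<Rightarrow> real \<Rightarrow> real \<Rightarrow> real \<Rightarrow> real \<Rightarrow> 'a nibble_state \<Rightarrow> bool" where
  "nibble_inv V E \<Delta> \<epsilon> p \<delta> D F st \<longleftrightarrow>
     unsampled st \<union> sampled st = E \<and> unsampled st \<inter> sampled st = {} \<and> failed st \<subseteq> E \<and>
     (\<forall>e\<in>unsampled st. (1 - \<delta>) * p \<le> real (card (palette E \<Delta> \<epsilon> st e)) \<and>
        real (card (palette E \<Delta> \<epsilon> st e)) \<le> (1 + \<delta>) * p) \<and>
     (\<forall>u\<in>V. \<forall>k\<in>color_range \<Delta> \<epsilon>. (1 - \<delta>) * p \<le> real (card (color_nbrs st u k)) \<and>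
        real (card (color_nbrs st u k)) \<le> (1 + \<delta>) * p) \<and>
     (\<forall>v\<in>V. real (vertex_degree (unsampled st) v) \<le> D \<and> real (vertex_degree (failed st) v) \<le> F)"

context nibble_step
begin

definition round_good :: "('a set \<Rightarrow> nat option option) \<Rightarrow> bool" where
  "round_good y \<longleftrightarrow>
     (\<forall>v\<in>V. \<bar>real (card (sampled_at v y)) - \<epsilon> * real (card (U_at v))\<bar> \<le> \<epsilon>\<^sup>2 * p) \<and>
     (\<forall>e\<in>U. \<bar>real (card (new_palette e y)) -
        measure_pmf.expectation Y (\<lambda>y. real (card (new_palette e y)))\<bar> \<le> \<epsilon>\<^sup>2 * p) \<and>
     (\<forall>u\<in>V. \<forall>k\<in>color_range \<Delta> \<epsilon>. \<bar>real (card (new_color_nbrs u k y)) -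
        measure_pmf.expectation Y (\<lambda>y. real (card (new_color_nbrs u k y)))\<bar> \<le> \<epsilon>\<^sup>2 * p) \<and>
     (\<forall>v\<in>V. real (card (failed_at v y)) \<le> failure_bound)"

text \<open>Each two-sided tail counts twice: sampled degrees per vertex, palettes per edge, color
  degrees per vertex and color. The one-sided failure bound adds a third unit per vertex.\<close>

lemma prob_not_round_good_le:
  "measure_pmf.prob Y {y. \<not> round_good y} \<le>
    (3 * real (card V) + 2 * real (card E) + 2 * real (card V * card (color_range \<Delta> \<epsilon>))) * fluctuation_bound"
proof -
  let ?M = "measure_pmf.prob Y"
  define A where "A v = {y. \<bar>real (card (sampled_at v y)) - \<epsilon> * real (card (U_at v))\<bar> > \<epsilon>\<^sup>2 * p}" for v
  define B where "B e = {y. \<bar>real (card (new_palette e y)) -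
        measure_pmf.expectation Y (\<lambda>y. real (card (new_palette e y)))\<bar> > \<epsilon>\<^sup>2 * p}" for e
  define C where "C uk = {y. \<bar>real (card (new_color_nbrs (fst uk) (snd uk) y)) -
        measure_pmf.expectation Y (\<lambda>y. real (card (new_color_nbrs (fst uk) (snd uk) y)))\<bar> > \<epsilon>\<^sup>2 * p}" for uk
  define D where "D v = {y. (\<forall>w\<in>V. real (card (sampled_at w y)) \<le> 3 * (\<epsilon> * \<Delta>)) \<and>
      real (card (failed_at v y)) > failure_bound}" for v
  \<comment> \<open>Off the events \<open>A\<close> the proviso inside \<open>D\<close> holds at
    every vertex, so avoiding \<open>D\<close> too yields the unconditional failure bound.\<close>
  have sampled: "real (card (sampled_at w y)) \<le> 3 * (\<epsilon> * \<Delta>)" if "w \<in> V" "y \<notin> A w" for w y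
  proof -
    have "real (card (sampled_at w y)) \<le> \<epsilon> * real (card (U_at w)) + \<epsilon>\<^sup>2 * p"
      using that by (simp add: A_def)
    also have "\<epsilon> * real (card (U_at w)) \<le> \<epsilon> * (2 * \<Delta>)"
      using card_U_at_le[OF that(1)] eps by (intro mult_left_mono) auto
    also have "\<epsilon>\<^sup>2 * p \<le> \<epsilon> * 1 * \<Delta>"
      unfolding power2_eq_square using eps p_le p_pos by (intro mult_mono) auto
    finally show ?thesis by (simp add: mult.commute)
  qed
  have "{y. \<not> round_good y} \<subseteq>
     ((\<Union>v\<in>V. A v) \<union> (\<Union>e\<in>U. B e)) \<union> ((\<Union>uk\<in>V \<times> color_range \<Delta> \<epsilon>. C uk) \<union> (\<Union>v\<in>V. D v))"
  proof
    fix y assume y: "y \<in> {y. \<not> round_good y}"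
    show "y \<in> ((\<Union>v\<in>V. A v) \<union> (\<Union>e\<in>U. B e)) \<union> ((\<Union>uk\<in>V \<times> color_range \<Delta> \<epsilon>. C uk) \<union> (\<Union>v\<in>V. D v))"
    proof (rule ccontr)
      assume n: "\<not> ?thesis"
      have A: "y \<notin> A v" if "v \<in> V" for v using n that by blast
      have B: "y \<notin> B e" if "e \<in> U" for e using n that by blast
      have C: "y \<notin> C (u, k)" if "u \<in> V" "k \<in> color_range \<Delta> \<epsilon>" for u k using n that by blast
      have "y \<notin> D v" if "v \<in> V" for v using n that by blast
      then have D: "real (card (failed_at v y)) \<le> failure_bound" if "v \<in> V" for v
        using sampled A that unfolding D_def mem_Collect_eq by (meson not_less)
      have "round_good y"
        unfolding round_good_def
      proof (intro conjI ballI)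
        fix v assume "v \<in> V"
        from A[OF this] show "\<bar>real (card (sampled_at v y)) - \<epsilon> * real (card (U_at v))\<bar> \<le> \<epsilon>\<^sup>2 * p"
          by (simp only: A_def mem_Collect_eq not_less)
      next
        fix e assume "e \<in> U"
        from B[OF this] show "\<bar>real (card (new_palette e y)) -
            measure_pmf.expectation Y (\<lambda>y. real (card (new_palette e y)))\<bar> \<le> \<epsilon>\<^sup>2 * p"
          by (simp only: B_def mem_Collect_eq not_less)
      next
        fix u k assume "u \<in> V" "k \<in> color_range \<Delta> \<epsilon>"
        from C[OF this] show "\<bar>real (card (new_color_nbrs u k y)) -
            measure_pmf.expectation Y (\<lambda>y. real (card (new_color_nbrs u k y)))\<bar> \<le> \<epsilon>\<^sup>2 * p"
          by (simp only: C_def mem_Collect_eq not_less fst_conv snd_conv)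
      qed (rule D)
      then show False using y by simp
    qed
  qed
  then have "?M {y. \<not> round_good y} \<le>
     ?M (((\<Union>v\<in>V. A v) \<union> (\<Union>e\<in>U. B e)) \<union> ((\<Union>uk\<in>V \<times> color_range \<Delta> \<epsilon>. C uk) \<union> (\<Union>v\<in>V. D v)))"
    by (intro measure_pmf.finite_measure_mono) auto
  also have "\<dots> \<le> (?M (\<Union>v\<in>V. A v) + ?M (\<Union>e\<in>U. B e)) +
      (?M (\<Union>uk\<in>V \<times> color_range \<Delta> \<epsilon>. C uk) + ?M (\<Union>v\<in>V. D v))"
    by (intro order_trans[OF measure_Un_le] add_mono measure_Un_le) auto
  also have "?M (\<Union>v\<in>V. A v) \<le> real (card V) * (2 * fluctuation_bound)"
    unfolding A_def using finite_V sampled_at_tail by (rule prob_UN_le)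
  also have "?M (\<Union>e\<in>U. B e) \<le> real (card U) * (2 * fluctuation_bound)"
    unfolding B_def using finite_U new_palette_tail by (rule prob_UN_le)
  also have "?M (\<Union>uk\<in>V \<times> color_range \<Delta> \<epsilon>. C uk) \<le> real (card (V \<times> color_range \<Delta> \<epsilon>)) * (2 * fluctuation_bound)"
    unfolding C_def using finite_V finite_color_range new_color_nbrs_tail by (intro prob_UN_le) auto
  also have "?M (\<Union>v\<in>V. D v) \<le> real (card V) * fluctuation_bound"
    unfolding D_def using finite_V prob_many_failures_le by (rule prob_UN_le)
  also have "real (card U) * (2 * fluctuation_bound) \<le> real (card E) * (2 * fluctuation_bound)"
    using card_mono[OF finite_E U_subset] by (intro mult_right_mono) (auto simp: fluctuation_bound_def)
  finally show ?thesis by (simp add: card_cartesian_product algebra_simps)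
qed

lemma expectation_new_palette:
  assumes e: "e \<in> U"
  shows "\<bar>measure_pmf.expectation Y (\<lambda>y. real (card (new_palette e y))) - (1 - \<epsilon>)\<^sup>2 * real (card (P e))\<bar>
    \<le> 10 * (\<epsilon> * \<delta>) * real (card (P e))"
proof -
  have "measure_pmf.expectation Y (\<lambda>y. real (card (new_palette e y))) =
      measure_pmf.expectation Y (\<lambda>y. real (card {k \<in> P e. k \<in> new_palette e y}))"
    by (intro Bochner_Integration.integral_cong refl arg_cong[where f = "\<lambda>X. real (card X)"])
      (auto simp: new_palette_def)
  also have "\<dots> = (\<Sum>k\<in>P e. measure_pmf.prob Y {y. k \<in> new_palette e y})"
    using finite_palette finite_set_Y by (rule expectation_card_filter)
  also have "\<dots> - (1 - \<epsilon>)\<^sup>2 * real (card (P e)) =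
      (\<Sum>k\<in>P e. measure_pmf.prob Y {y. k \<in> new_palette e y} - (1 - \<epsilon>)\<^sup>2)"
    by (simp add: sum_subtractf)
  also have "\<bar>\<dots>\<bar> \<le> (\<Sum>k\<in>P e. \<bar>measure_pmf.prob Y {y. k \<in> new_palette e y} - (1 - \<epsilon>)\<^sup>2\<bar>)"
    by (rule sum_abs)
  also have "\<dots> \<le> real (card (P e)) * (10 * (\<epsilon> * \<delta>))"
    using prob_palette_survival[OF e] by (rule sum_bounded_above)
  finally show ?thesis by (simp add: mult.commute)
qed

lemma expectation_new_color_nbrs:
  assumes u: "u \<in> V" and k: "k \<in> color_range \<Delta> \<epsilon>"
  shows "\<bar>measure_pmf.expectation Y (\<lambda>y. real (card (new_color_nbrs u k y))) - (1 - \<epsilon>)\<^sup>2 * real (card (color_nbrs st u k))\<bar>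
    \<le> 10 * (\<epsilon> * \<delta>) * real (card (color_nbrs st u k))"
proof -
  have "measure_pmf.expectation Y (\<lambda>y. real (card (new_color_nbrs u k y))) =
      measure_pmf.expectation Y (\<lambda>y. real (card {w \<in> color_nbrs st u k. w \<in> new_color_nbrs u k y}))"
    by (intro Bochner_Integration.integral_cong refl arg_cong[where f = "\<lambda>X. real (card X)"])
      (auto simp: new_color_nbrs_def)
  also have "\<dots> = (\<Sum>w\<in>color_nbrs st u k. measure_pmf.prob Y {y. w \<in> new_color_nbrs u k y})"
    using finite_color_nbrs finite_set_Y by (rule expectation_card_filter)
  also have "\<dots> - (1 - \<epsilon>)\<^sup>2 * real (card (color_nbrs st u k)) =
      (\<Sum>w\<in>color_nbrs st u k. measure_pmf.prob Y {y. w \<in> new_color_nbrs u k y} - (1 - \<epsilon>)\<^sup>2)"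
    by (simp add: sum_subtractf)
  also have "\<bar>\<dots>\<bar> \<le> (\<Sum>w\<in>color_nbrs st u k. \<bar>measure_pmf.prob Y {y. w \<in> new_color_nbrs u k y} - (1 - \<epsilon>)\<^sup>2\<bar>)"
    by (rule sum_abs)
  also have "\<dots> \<le> real (card (color_nbrs st u k)) * (10 * (\<epsilon> * \<delta>))"
    using prob_color_nbr_survival[OF u k] by (rule sum_bounded_above)
  finally show ?thesis by (simp add: mult.commute)
qed

section \<open>The state after a round in terms of its outcome\<close>

lemma unsampled_apply: "unsampled (apply_outcome E st y) = {e \<in> U. y e = None}"
  by (auto simp: apply_outcome_def outcome_sample_def Let_def)

lemma sampled_apply: "sampled (apply_outcome E st y) = sampled st \<union> {e \<in> U. y e \<noteq> None}"
  by (auto simp: apply_outcome_def outcome_sample_def Let_def)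

lemma tentative_apply:
  "tentative (apply_outcome E st y) e = (if e \<in> U \<and> y e \<noteq> None then the (y e) else tentative st e)"
  by (auto simp: apply_outcome_def outcome_sample_def Let_def)

text \<open>Previously sampled edges lie outside \<open>U\<close>, so their colors are not
  overwritten; the newly blocked colors are exactly those picked by adjacent edges of
  \<open>U\<close>.\<close>

lemma palette_apply:
  assumes "e \<in> U" "y e = None"
  shows "palette E \<Delta> \<epsilon> (apply_outcome E st y) e = new_palette e y"
proof -
  let ?st = "apply_outcome E st y"
  have blocked: "(\<exists>e'\<in>adjacent_edges E e \<inter> sampled ?st. tentative ?st e' = Some k) \<longleftrightarrow>
      (\<exists>e'\<in>adjacent_edges E e \<inter> sampled st. tentative st e' = Some k) \<or>
      (\<exists>e'\<in>{e'\<in>U. e' \<noteq> e \<and> e' \<inter> e \<noteq> {}}. y e' = Some (Some k))" (is "?L \<longleftrightarrow> ?A \<or> ?B") for k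
  proof
    assume ?L
    then obtain e' where e': "e' \<in> adjacent_edges E e" "e' \<in> sampled ?st" "tentative ?st e' = Some k"
      by blast
    show "?A \<or> ?B"
    proof (cases "e' \<in> U \<and> y e' \<noteq> None")
      case True
      then have "the (y e') = Some k" using e'(3) by (simp add: tentative_apply)
      then have "y e' = Some (Some k)" using True by (metis option.collapse)
      moreover have "e' \<noteq> e" "e' \<inter> e \<noteq> {}" using e'(1) by (simp_all add: adjacent_edges_def Int_commute)
      ultimately have ?B using True by blast
      then show ?thesis ..
    next
      case False
      then have "e' \<in> sampled st" using e'(2) unfolding sampled_apply by blast
      moreover have "tentative st e' = Some k" using e'(3) unfolding tentative_apply if_not_P[OF False] .
      ultimately show ?thesis using e'(1) by blast
    qed
  next
    assume "?A \<or> ?B"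
    then show ?L
    proof
      assume ?A
      then obtain e' where e': "e' \<in> adjacent_edges E e" "e' \<in> sampled st" "tentative st e' = Some k" by blast
      then have "e' \<notin> U" using partition by blast
      then have "e' \<in> sampled ?st" "tentative ?st e' = Some k"
        using e' by (simp_all add: sampled_apply tentative_apply)
      then show ?L using e'(1) by blast
    next
      assume ?B
      then obtain e' where e': "e' \<in> U" "e' \<noteq> e" "e' \<inter> e \<noteq> {}" "y e' = Some (Some k)" by blast
      then have "e' \<in> sampled ?st" "tentative ?st e' = Some k"
        by (simp_all add: sampled_apply tentative_apply)
      moreover have "e' \<in> adjacent_edges E e"
        using e' U_subset unfolding adjacent_edges_def by blast
      ultimately show ?L by blast
    qed
  qed
  show ?thesis unfolding palette_def new_palette_def blocked by blast
qed

lemma color_used_apply: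
  "color_used (apply_outcome E st y) w k \<longleftrightarrow> color_used st w k \<or> (\<exists>e\<in>U_at w. y e = Some (Some k))"
proof
  assume "color_used (apply_outcome E st y) w k"
  then obtain e where e: "e \<in> sampled st \<union> {e \<in> U. y e \<noteq> None}" "w \<in> e"
    "(if e \<in> U \<and> y e \<noteq> None then the (y e) else tentative st e) = Some k"
    unfolding color_used_def sampled_apply tentative_apply by blast
  then show "color_used st w k \<or> (\<exists>e\<in>U_at w. y e = Some (Some k))"
    by (auto simp: color_used_def U_at_def split: if_splits)
next
  assume "color_used st w k \<or> (\<exists>e\<in>U_at w. y e = Some (Some k))"
  then show "color_used (apply_outcome E st y) w k"
  proof
    assume "color_used st w k"
    then obtain e where "e \<in> sampled st" "w \<in> e" "tentative st e = Some k" by (auto simp: color_used_def)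
    moreover then have "e \<notin> U" using partition by auto
    ultimately show ?thesis unfolding color_used_def
      by (intro bexI[of _ e]) (auto simp: sampled_apply tentative_apply)
  next
    assume "\<exists>e\<in>U_at w. y e = Some (Some k)"
    then obtain e where "e \<in> U" "w \<in> e" "y e = Some (Some k)" by (auto simp: U_at_def)
    then show ?thesis unfolding color_used_def
      by (intro bexI[of _ e]) (auto simp: sampled_apply tentative_apply)
  qed
qed

lemma color_nbrs_apply: "color_nbrs (apply_outcome E st y) u k = new_color_nbrs u k y"
  unfolding color_nbrs_def new_color_nbrs_def color_used_apply unsampled_apply by blast

lemma degree_unsampled_apply:
  "real (vertex_degree (unsampled (apply_outcome E st y)) v) = real (card (U_at v)) - real (card (sampled_at v y))"
proof -
  have "{e \<in> unsampled (apply_outcome E st y). v \<in> e} = U_at v - sampled_at v y"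
    by (auto simp: unsampled_apply U_at_def sampled_at_def)
  moreover have "sampled_at v y \<subseteq> U_at v" by (auto simp: sampled_at_def)
  ultimately show ?thesis unfolding vertex_degree_def
    using finite_U_at card_mono[of "U_at v" "sampled_at v y"]
    by (simp add: card_Diff_subset finite_subset of_nat_diff)
qed

lemma failed_apply_subset:
  assumes "failed st \<subseteq> E"
  shows "failed (apply_outcome E st y) \<subseteq> E"
  using assms U_subset by (auto simp: apply_outcome_def Let_def failed_edges_def outcome_sample_def)

lemma degree_failed_apply:
  assumes "failed st \<subseteq> E"
  shows "vertex_degree (failed (apply_outcome E st y)) v \<le> vertex_degree (failed st) v + card (failed_at v y)"
proof -
  have "{e \<in> failed (apply_outcome E st y). v \<in> e} \<subseteq> {e \<in> failed st. v \<in> e} \<union> failed_at v y"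
  proof
    fix e assume e: "e \<in> {e \<in> failed (apply_outcome E st y). v \<in> e}"
    show "e \<in> {e \<in> failed st. v \<in> e} \<union> failed_at v y"
    proof (cases "e \<in> failed st")
      case False
      then have "e \<in> failed_edges E (outcome_sample st y) (\<lambda>e. the (y e))" and v: "v \<in> e"
        using e by (auto simp: apply_outcome_def Let_def)
      then have eU: "e \<in> U" "y e \<noteq> None"
        and "the (y e) = None \<or> (\<exists>e'\<in>adjacent_edges E e \<inter> outcome_sample st y. the (y e) = the (y e'))"
        by (simp_all add: failed_edges_def outcome_sample_def)
      then have "y e = Some None \<or> (\<exists>e'\<in>U. e' \<noteq> e \<and> e \<inter> e' \<noteq> {} \<and> y e' = y e)"
      proof (elim disjE bexE)
        assume "the (y e) = None"
        then show ?thesis using eU by (metis option.collapse)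
      next
        fix e' assume e': "e' \<in> adjacent_edges E e \<inter> outcome_sample st y" "the (y e) = the (y e')"
        then have "e' \<in> U" "e' \<noteq> e" "e \<inter> e' \<noteq> {}" "y e' \<noteq> None"
          by (simp_all add: adjacent_edges_def outcome_sample_def)
        \<comment> \<open>Both outcomes differ from \<open>None\<close>, so equality under
          \<open>the\<close> lifts to the outcomes themselves.\<close>
        moreover have "y e' = y e" using e'(2) eU calculation(4) by (metis option.expand)
        ultimately show ?thesis by blast
      qed
      moreover have "e \<in> sampled_at v y" using eU v by (simp add: sampled_at_def U_at_def)
      ultimately show ?thesis unfolding failed_at_def by blast
    qed (use e in blast)
  qed
  moreover have "finite {e \<in> failed st. v \<in> e}" using assms finite_E finite_subset by fastforce
  ultimately have "vertex_degree (failed (apply_outcome E st y)) v \<le> card ({e \<in> failed st. v \<in> e} \<union> failed_at v y)"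
    unfolding vertex_degree_def using finite_failed_at by (intro card_mono) auto
  also have "\<dots> \<le> card {e \<in> failed st. v \<in> e} + card (failed_at v y)" by (rule card_Un_le)
  finally show ?thesis by (simp add: vertex_degree_def)
qed

text \<open>The deterministic half of a round: on a good outcome, expectation and deviation add up
  to the error that \<open>shrink_relative_error\<close> tolerates.\<close>

lemma round_good_imp_inv:
  assumes inv: "nibble_inv V E \<Delta> \<epsilon> p \<delta> D F st" and y: "round_good y"
  shows "nibble_inv V E \<Delta> \<epsilon> ((1 - \<epsilon>)\<^sup>2 * p) ((1 + 48 * \<epsilon>) * \<delta>) ((1 - \<epsilon>) * D + \<epsilon>\<^sup>2 * p) (F + failure_bound)
    (apply_outcome E st y)"
  unfolding nibble_inv_def
proof (intro conjI ballI)
  have fail: "failed st \<subseteq> E" using inv by (simp add: nibble_inv_def)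
  show "unsampled (apply_outcome E st y) \<union> sampled (apply_outcome E st y) = E"
    "unsampled (apply_outcome E st y) \<inter> sampled (apply_outcome E st y) = {}"
    using partition by (auto simp: unsampled_apply sampled_apply)
  show "failed (apply_outcome E st y) \<subseteq> E" using fail by (rule failed_apply_subset)
  {
    fix e assume e: "e \<in> unsampled (apply_outcome E st y)"
    then have e': "e \<in> U" "y e = None" by (auto simp: unsampled_apply)
    have "\<bar>real (card (new_palette e y)) - (1 - \<epsilon>)\<^sup>2 * real (card (P e))\<bar> \<le>
        10 * (\<epsilon> * \<delta>) * real (card (P e)) + \<epsilon>\<^sup>2 * p"
    proof -
      have "\<bar>real (card (new_palette e y)) -
          measure_pmf.expectation Y (\<lambda>y. real (card (new_palette e y)))\<bar> \<le> \<epsilon>\<^sup>2 * p"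
        using y e'(1) unfolding round_good_def by blast
      then show ?thesis using expectation_new_palette[OF e'(1)] by linarith
    qed
    from shrink_relative_error[OF palette_ge[OF e'(1)] palette_le[OF e'(1)] this eps delta p_pos]
    show "(1 - (1 + 48 * \<epsilon>) * \<delta>) * ((1 - \<epsilon>)\<^sup>2 * p) \<le> real (card (palette E \<Delta> \<epsilon> (apply_outcome E st y) e))"
      "real (card (palette E \<Delta> \<epsilon> (apply_outcome E st y) e)) \<le> (1 + (1 + 48 * \<epsilon>) * \<delta>) * ((1 - \<epsilon>)\<^sup>2 * p)"
      unfolding palette_apply[of e y, OF e'] by auto
  }
  {
    fix u k assume uk: "u \<in> V" "k \<in> color_range \<Delta> \<epsilon>"
    have "\<bar>real (card (new_color_nbrs u k y)) - (1 - \<epsilon>)\<^sup>2 * real (card (color_nbrs st u k))\<bar> \<le>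
        10 * (\<epsilon> * \<delta>) * real (card (color_nbrs st u k)) + \<epsilon>\<^sup>2 * p"
    proof -
      have "\<bar>real (card (new_color_nbrs u k y)) -
          measure_pmf.expectation Y (\<lambda>y. real (card (new_color_nbrs u k y)))\<bar> \<le> \<epsilon>\<^sup>2 * p"
        using y uk unfolding round_good_def by blast
      then show ?thesis using expectation_new_color_nbrs[OF uk] by linarith
    qed
    from shrink_relative_error[OF color_nbrs_ge[OF uk] color_nbrs_le[OF uk] this eps delta p_pos]
    show "(1 - (1 + 48 * \<epsilon>) * \<delta>) * ((1 - \<epsilon>)\<^sup>2 * p) \<le> real (card (color_nbrs (apply_outcome E st y) u k))"
      "real (card (color_nbrs (apply_outcome E st y) u k)) \<le> (1 + (1 + 48 * \<epsilon>) * \<delta>) * ((1 - \<epsilon>)\<^sup>2 * p)"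
      unfolding color_nbrs_apply by auto
  }
  fix v assume v: "v \<in> V"
  have D: "real (card (U_at v)) \<le> D"
    using inv v by (simp add: nibble_inv_def vertex_degree_def U_at_def)
  have "\<bar>real (card (sampled_at v y)) - \<epsilon> * real (card (U_at v))\<bar> \<le> \<epsilon>\<^sup>2 * p"
    using y v by (simp add: round_good_def)
  moreover have "(1 - \<epsilon>) * real (card (U_at v)) \<le> (1 - \<epsilon>) * D" using D eps by (intro mult_left_mono) auto
  ultimately show "real (vertex_degree (unsampled (apply_outcome E st y)) v) \<le> (1 - \<epsilon>) * D + \<epsilon>\<^sup>2 * p"
    unfolding degree_unsampled_apply left_diff_distrib by linarith
  have "real (card (failed_at v y)) \<le> failure_bound" "real (vertex_degree (failed st) v) \<le> F"
    using y v inv by (auto simp: round_good_def nibble_inv_def)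
  then show "real (vertex_degree (failed (apply_outcome E st y)) v) \<le> F + failure_bound"
    using degree_failed_apply[OF fail, of y v] by linarith
qed

end

text \<open>Stated outside the locale, so that \<open>p\<close>, \<open>\<delta>\<close>,
  \<open>D\<close> and \<open>F\<close> can change from round to round.\<close>

lemma prob_round_breaks_inv_le:
  assumes inv: "nibble_inv V E \<Delta> \<epsilon> p \<delta> D F st" and graph: "simple_graph V E" and D: "D \<le> 2 * \<Delta>"
    and eps: "0 < \<epsilon>" "\<epsilon> \<le> 1 / 10000" and delta: "\<epsilon> \<le> \<delta>" "\<delta> \<le> 1 / 100"
    and p: "sqrt \<epsilon> * \<Delta> \<le> p" "8 / \<epsilon> \<le> p" "p \<le> \<Delta>"
  shows "measure_pmf.prob (nibble_round E \<Delta> \<epsilon> st) (- {st'. nibble_inv V E \<Delta> \<epsilon> ((1 - \<epsilon>)\<^sup>2 * p)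
      ((1 + 48 * \<epsilon>) * \<delta>) ((1 - \<epsilon>) * D + \<epsilon>\<^sup>2 * p) (F + 12 * (\<epsilon> * sqrt \<epsilon> * \<Delta>)) st'}) \<le>
    (3 * real (card V) + 2 * real (card E) + 2 * real (card V * card (color_range \<Delta> \<epsilon>))) *
      exp (- (\<epsilon> ^ 4 * p) / 2)"
proof -
  interpret nibble_step V E \<Delta> \<epsilon> st p \<delta>
  proof
    fix v assume "v \<in> V"
    then have "real (vertex_degree (unsampled st) v) \<le> D" using inv by (simp add: nibble_inv_def)
    then show "real (vertex_degree (unsampled st) v) \<le> 2 * \<Delta>" using D by linarith
  qed (use inv assms in \<open>simp_all add: nibble_inv_def\<close>)
  let ?I = "{st'. nibble_inv V E \<Delta> \<epsilon> ((1 - \<epsilon>)\<^sup>2 * p)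
      ((1 + 48 * \<epsilon>) * \<delta>) ((1 - \<epsilon>) * D + \<epsilon>\<^sup>2 * p) (F + 12 * (\<epsilon> * sqrt \<epsilon> * \<Delta>)) st'}"
  have "measure_pmf.prob (nibble_round E \<Delta> \<epsilon> st) (- ?I) = measure_pmf.prob Y (apply_outcome E st -` (- ?I))"
    using finite_U by (simp add: nibble_round_eq_map_outcome measure_map_pmf)
  also have "\<dots> \<le> measure_pmf.prob Y {y. \<not> round_good y}"
    using round_good_imp_inv[OF inv] by (intro measure_pmf.finite_measure_mono) (auto simp: failure_bound_def)
  also note prob_not_round_good_le
  finally show ?thesis unfolding fluctuation_bound_def .
qed

section \<open>Iterating the rounds\<close>

lemma real_card_color_range:
  assumes "0 \<le> (1 + \<epsilon>\<^sup>2) * \<Delta>"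
  shows "real (card (color_range \<Delta> \<epsilon>)) \<le> (1 + \<epsilon>\<^sup>2) * \<Delta>"
    and "(1 + \<epsilon>\<^sup>2) * \<Delta> - 1 \<le> real (card (color_range \<Delta> \<epsilon>))"
proof -
  have "color_range \<Delta> \<epsilon> = {1..nat \<lfloor>(1 + \<epsilon>\<^sup>2) * \<Delta>\<rfloor>}"
    using assms by (auto simp: color_range_def le_nat_floor) (simp add: le_nat_iff le_floor_iff)
  then have "card (color_range \<Delta> \<epsilon>) = nat \<lfloor>(1 + \<epsilon>\<^sup>2) * \<Delta>\<rfloor>" by simp
  moreover have "0 \<le> \<lfloor>(1 + \<epsilon>\<^sup>2) * \<Delta>\<rfloor>" using assms by simp
  ultimately have "real (card (color_range \<Delta> \<epsilon>)) = of_int \<lfloor>(1 + \<epsilon>\<^sup>2) * \<Delta>\<rfloor>" by simp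
  then show "real (card (color_range \<Delta> \<epsilon>)) \<le> (1 + \<epsilon>\<^sup>2) * \<Delta>"
    "(1 + \<epsilon>\<^sup>2) * \<Delta> - 1 \<le> real (card (color_range \<Delta> \<epsilon>))"
    by linarith+
qed

definition palette_scale :: "real \<Rightarrow> real \<Rightarrow> nat \<Rightarrow> real" where
  "palette_scale \<Delta> \<epsilon> i = (1 - \<epsilon>) ^ (2 * i) * \<Delta>"

definition relative_error :: "real \<Rightarrow> nat \<Rightarrow> real" where
  "relative_error \<epsilon> i = \<epsilon> * (1 + 48 * \<epsilon>) ^ i"

text \<open>The unsampled degree carries the same relative error as the palettes; its growth in each
  round absorbs the additive fluctuation of the degree.\<close>

definition round_inv ::
    "'a set \<Rightarrow> 'a set set \<Rightarrow> real \<Rightarrow> real \<Rightarrow> nat \<Rightarrow> 'a nibble_state \<Rightarrow> bool" where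
  "round_inv V E \<Delta> \<epsilon> i = nibble_inv V E \<Delta> \<epsilon> (palette_scale \<Delta> \<epsilon> i) (relative_error \<epsilon> i)
     ((1 + relative_error \<epsilon> i) * ((1 - \<epsilon>) ^ i * \<Delta>)) (real i * (12 * (\<epsilon> * sqrt \<epsilon> * \<Delta>)))"

lemma nibble_inv_mono:
  assumes "nibble_inv V E \<Delta> \<epsilon> p \<delta> D F st" "D \<le> D'" "F \<le> F'"
  shows "nibble_inv V E \<Delta> \<epsilon> p \<delta> D' F' st"
  using assms unfolding nibble_inv_def by (meson order_trans)

text \<open>\<open>Delta_large\<close> is the sixth power of the lower bound on
  \<open>\<epsilon>\<close>. Two vertices make the logarithm positive.\<close>

locale nibble_parameters =
  fixes V :: "'a set" and E :: "'a set set" and \<Delta> \<epsilon> :: real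
  assumes graph: "simple_graph V E" and n: "2 \<le> card V"
    and eps: "0 < \<epsilon>" "\<epsilon> \<le> 1 / 10000"
    and Delta_large: "10 ^ 6 * ln (real (card V)) \<le> \<epsilon> ^ 6 * \<Delta>"
    and degrees: "\<And>v. v \<in> V \<Longrightarrow> (1 - \<epsilon>\<^sup>2) * \<Delta> \<le> real (vertex_degree E v)"
      "\<And>v. v \<in> V \<Longrightarrow> real (vertex_degree E v) \<le> (1 + \<epsilon>\<^sup>2) * \<Delta>"
begin

section \<open>Numerical consequences of the hypotheses\<close>

lemma finite_V: "finite V" using graph by (simp add: simple_graph_def)

lemma finite_E: "finite E"
  using graph finite_subset[of E "Pow V"] by (auto simp: simple_graph_def)

lemma ln_n: "1 / 2 \<le> ln (real (card V))"
proof -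
  have "1 / 2 \<le> ln (2 :: real)" using ln2_ge_two_thirds by simp
  also have "\<dots> \<le> ln (real (card V))" using n by simp
  finally show ?thesis .
qed

lemma eps6_Delta: "1 \<le> \<epsilon> ^ 6 * \<Delta>"
  using Delta_large ln_n by simp

lemma Delta_pos: "0 < \<Delta>"
  using eps6_Delta eps by (smt (verit) zero_less_mult_pos zero_less_power)

lemma Delta_ge: "1 / \<epsilon> ^ 6 \<le> \<Delta>"
  using eps6_Delta eps by (simp add: divide_le_eq mult.commute)

text \<open>Every power of \<open>\<epsilon>\<close> becomes an exponential in \<open>ell\<close>,
  so that the final comparisons are linear in the exponents.\<close>

definition ell :: real where "ell = ln (1 / \<epsilon>)"

lemma ell_pos: "0 < ell" using eps by (simp add: ell_def)

lemma exp_ell: "exp (- ell) = \<epsilon>" "\<epsilon> powr x = exp (- (x * ell))" "sqrt \<epsilon> = exp (- (ell / 2))"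
proof -
  have l: "ell = - ln \<epsilon>" using eps by (simp add: ell_def ln_div)
  show "exp (- ell) = \<epsilon>" using eps by (simp add: l)
  show 1: "\<epsilon> powr x = exp (- (x * ell))" for x using eps by (simp add: l powr_def)
  show "sqrt \<epsilon> = exp (- (ell / 2))" using eps 1[of "1/2"] by (simp add: powr_half_sqrt)
qed

lemma sqrt_eps_small: "sqrt \<epsilon> \<le> 1 / 100"
  by (rule real_le_lsqrt) (use eps in \<open>auto simp: power2_eq_square\<close>)

text \<open>96 is \<open>2 * nibble_K\<close>, from the definition of \<open>t_eps\<close>.\<close>

lemma rounds_le:
  assumes "i \<le> t_eps \<epsilon>"
  shows "real i * \<epsilon> \<le> ell / 96"
proof -
  have "0 \<le> ell / (96 * \<epsilon>)" using ell_pos eps by simp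
  then have "real (t_eps \<epsilon>) \<le> ell / (96 * \<epsilon>)" by (simp add: t_eps_def nibble_K_def ell_def)
  then have "real i \<le> ell / (96 * \<epsilon>)" using assms by linarith
  then have "real i * \<epsilon> \<le> ell / (96 * \<epsilon>) * \<epsilon>" using eps by (intro mult_right_mono) auto
  then show ?thesis using eps by simp
qed

lemma relative_error_ge: "\<epsilon> \<le> relative_error \<epsilon> i"
  using eps one_le_power[of "1 + 48 * \<epsilon>" i] by (simp add: relative_error_def)

text \<open>The growth over all rounds is at most \<open>exp (48 * (ell / 96))\<close>, the inverse
  of \<open>sqrt \<epsilon>\<close>. This is the reason for the factor \<open>2 * nibble_K\<close>
  in \<open>t_eps\<close>.\<close>

lemma relative_error_le:
  assumes "i \<le> t_eps \<epsilon>"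
  shows "relative_error \<epsilon> i \<le> 1 / 100"
proof -
  have "(1 + 48 * \<epsilon>) ^ i \<le> exp (48 * \<epsilon>) ^ i"
    using eps exp_ge_add_one_self[of "48 * \<epsilon>"] by (intro power_mono) auto
  also have "\<dots> = exp (48 * (real i * \<epsilon>))" by (simp add: exp_of_nat_mult[symmetric] mult_ac)
  also have "\<dots> \<le> exp (ell / 2)" using rounds_le[OF assms] by simp
  finally have "relative_error \<epsilon> i \<le> exp (- ell) * exp (ell / 2)"
    unfolding relative_error_def exp_ell(1) using eps by (intro mult_left_mono) auto
  also have "\<dots> = sqrt \<epsilon>" unfolding exp_ell(3) by (simp add: exp_add[symmetric])
  finally show ?thesis using sqrt_eps_small by linarith
qed

text \<open>Since \<open>exp (- (2 * \<epsilon>)) \<le> 1 - \<epsilon>\<close>, the scale stays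
  above \<open>exp (- (ell / 24)) * \<Delta>\<close>, which leaves much room over
  \<open>sqrt \<epsilon> * \<Delta>\<close>.\<close>

lemma palette_scale_ge:
  assumes "i \<le> t_eps \<epsilon>"
  shows "sqrt \<epsilon> * \<Delta> \<le> palette_scale \<Delta> \<epsilon> i" "8 / \<epsilon> \<le> palette_scale \<Delta> \<epsilon> i"
proof -
  have "1 \<le> (1 - \<epsilon>) * (1 + 2 * \<epsilon>)"
    using eps mult_right_mono[of \<epsilon> "1/2" \<epsilon>] by (simp add: algebra_simps)
  also have "\<dots> \<le> (1 - \<epsilon>) * exp (2 * \<epsilon>)"
    using eps exp_ge_add_one_self[of "2 * \<epsilon>"] by (intro mult_left_mono) auto
  finally have "exp (- (2 * \<epsilon>)) \<le> 1 - \<epsilon>" by (simp add: exp_minus field_simps)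
  then have pw: "exp (- (2 * \<epsilon>)) ^ (2 * i) \<le> (1 - \<epsilon>) ^ (2 * i)" by (intro power_mono) auto
  have "sqrt \<epsilon> \<le> exp (- (4 * (real i * \<epsilon>)))"
    unfolding exp_ell(3) using rounds_le[OF assms] ell_pos by simp
  also have "\<dots> = exp (- (2 * \<epsilon>)) ^ (2 * i)" by (simp add: exp_of_nat_mult[symmetric] mult_ac)
  also note pw
  finally show 1: "sqrt \<epsilon> * \<Delta> \<le> palette_scale \<Delta> \<epsilon> i"
    unfolding palette_scale_def using Delta_pos by (intro mult_right_mono) auto
  \<comment> \<open>Uses that \<open>\<Delta>\<close> is at least \<open>1 / \<epsilon> ^ 6\<close>,
    while \<open>sqrt \<epsilon>\<close> is at least \<open>\<epsilon>\<close>.\<close>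
  have "8 / \<epsilon> \<le> \<epsilon> * (1 / \<epsilon> ^ 6)"
  proof -
    have "\<epsilon> ^ 4 \<le> \<epsilon> ^ 1" using eps by (intro power_decreasing) auto
    then have "8 * \<epsilon> ^ 4 \<le> 1" using eps by simp
    then show ?thesis using eps by (simp add: field_simps power_numeral_reduce)
  qed
  also have "\<dots> \<le> sqrt \<epsilon> * \<Delta>"
  proof (intro mult_mono)
    have "sqrt \<epsilon> * sqrt \<epsilon> \<le> sqrt \<epsilon> * 1" using sqrt_eps_small eps by (intro mult_left_mono) auto
    then show "\<epsilon> \<le> sqrt \<epsilon>" using eps by simp
  qed (use Delta_ge eps in auto)
  finally show "8 / \<epsilon> \<le> palette_scale \<Delta> \<epsilon> i" using 1 by linarith
qed

lemma palette_scale_le: "palette_scale \<Delta> \<epsilon> i \<le> \<Delta>"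
  using eps Delta_pos power_le_one[of "1 - \<epsilon>" "2 * i"] by (simp add: palette_scale_def)

text \<open>The scale of the current round is replaced by its lower bound
  \<open>sqrt \<epsilon> * \<Delta>\<close>, so that one number serves all rounds.\<close>

definition round_failure :: real where
  "round_failure = (3 * real (card V) + 2 * real (card E) + 2 * real (card V * card (color_range \<Delta> \<epsilon>))) *
      exp (- (\<epsilon> ^ 4 * (sqrt \<epsilon> * \<Delta>)) / 2)"

text \<open>All palettes are the full color range and all color degrees are vertex degrees. Rounding
  loses at most one color, and \<open>1 \<le> \<epsilon> * \<Delta>\<close> covers that
  loss.\<close>

lemma round_inv_initial: "round_inv V E \<Delta> \<epsilon> 0 (initial_state E)"
proof -
  have e2: "\<epsilon>\<^sup>2 * \<Delta> \<le> \<epsilon> * \<Delta>" "0 \<le> \<epsilon>\<^sup>2 * \<Delta>"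
    using eps Delta_pos by (auto simp: power2_eq_square)
  have "1 \<le> \<epsilon> * \<Delta>"
  proof -
    have "\<epsilon> ^ 6 * \<Delta> \<le> \<epsilon> ^ 1 * \<Delta>" using eps Delta_pos by (intro mult_right_mono power_decreasing) auto
    then show ?thesis using eps6_Delta by simp
  qed
  have c: "(1 - \<epsilon>) * \<Delta> \<le> real (card (color_range \<Delta> \<epsilon>))" "real (card (color_range \<Delta> \<epsilon>)) \<le> (1 + \<epsilon>) * \<Delta>"
    using real_card_color_range[of \<epsilon> \<Delta>] Delta_pos e2 \<open>1 \<le> \<epsilon> * \<Delta>\<close>
    unfolding distrib_right left_diff_distrib by linarith+
  have d: "(1 - \<epsilon>) * \<Delta> \<le> real (vertex_degree E v)" "real (vertex_degree E v) \<le> (1 + \<epsilon>) * \<Delta>"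
    if "v \<in> V" for v
    using degrees[OF that] e2 unfolding distrib_right left_diff_distrib by linarith+
  have pal: "palette E \<Delta> \<epsilon> (initial_state E) e = color_range \<Delta> \<epsilon>" for e
    by (simp add: palette_def color_range_def initial_state_def)
  have "card (color_nbrs (initial_state E) u k) = vertex_degree E u" for u k
  proof -
    have "color_nbrs (initial_state E) u k = {w. {u, w} \<in> E}"
      by (simp add: color_nbrs_def color_used_def initial_state_def)
    moreover have image: "(\<lambda>w. {u, w}) ` {w. {u, w} \<in> E} = {e \<in> E. u \<in> e}"
    proof (intro equalityI subsetI)
      fix e assume e: "e \<in> {e \<in> E. u \<in> e}"
      then have "card e = 2" using graph by (auto simp: simple_graph_def)
      then obtain a b where "e = {a, b}" by (auto simp: card_2_iff)
      then have "e = {u, b} \<or> e = {u, a}" using e by blast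
      then show "e \<in> (\<lambda>w. {u, w}) ` {w. {u, w} \<in> E}" using e by blast
    qed blast
    moreover have "inj_on (\<lambda>w. {u, w}) {w. {u, w} \<in> E}"
      by (simp add: inj_on_def doubleton_eq_iff)
    from card_image[OF this] have "card {w. {u, w} \<in> E} = card {e \<in> E. u \<in> e}" unfolding image ..
    ultimately show ?thesis unfolding vertex_degree_def by (simp only:)
  qed
  moreover have "unsampled (initial_state E) = E" "sampled (initial_state E) = {}"
    "failed (initial_state E) = {}" "vertex_degree {} v = 0" for v :: 'a
    by (simp_all add: initial_state_def vertex_degree_def)
  moreover have "palette_scale \<Delta> \<epsilon> 0 = \<Delta>" "relative_error \<epsilon> 0 = \<epsilon>"
    by (simp_all add: palette_scale_def relative_error_def)
  ultimately show ?thesis using c d unfolding round_inv_def nibble_inv_def pal by simp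
qed

lemma prob_round_inv_step:
  assumes inv: "round_inv V E \<Delta> \<epsilon> i st" and i: "i \<le> t_eps \<epsilon>"
  shows "measure_pmf.prob (nibble_round E \<Delta> \<epsilon> st) (- {st'. round_inv V E \<Delta> \<epsilon> (Suc i) st'}) \<le> round_failure"
proof -
  let ?d = "relative_error \<epsilon> i" and ?p = "palette_scale \<Delta> \<epsilon> i"
  let ?D = "(1 + relative_error \<epsilon> i) * ((1 - \<epsilon>) ^ i * \<Delta>)"
  let ?F = "real i * (12 * (\<epsilon> * sqrt \<epsilon> * \<Delta>))"
  have d: "\<epsilon> \<le> ?d" "?d \<le> 1 / 100" using relative_error_ge relative_error_le[OF i] by auto
  have a1: "0 \<le> (1 - \<epsilon>) ^ i" "(1 - \<epsilon>) ^ i \<le> 1" using eps by (auto intro: power_le_one)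
  have "?D \<le> 2 * (1 * \<Delta>)" using d eps a1 Delta_pos by (intro mult_mono) auto
  then have D: "?D \<le> 2 * \<Delta>" by simp
  have p': "palette_scale \<Delta> \<epsilon> (Suc i) = (1 - \<epsilon>)\<^sup>2 * ?p"
    by (simp add: palette_scale_def power2_eq_square)
  have d': "relative_error \<epsilon> (Suc i) = (1 + 48 * \<epsilon>) * ?d" by (simp add: relative_error_def)
  have F': "real (Suc i) * (12 * (\<epsilon> * sqrt \<epsilon> * \<Delta>)) = ?F + 12 * (\<epsilon> * sqrt \<epsilon> * \<Delta>)"
    by (simp add: algebra_simps)
  \<comment> \<open>The scale shrinks twice as fast as the degree, so
    \<open>\<epsilon>^2 * ?p\<close> has a spare factor \<open>(1 - \<epsilon>) ^ i\<close> and fits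
    into the growth of the relative error.\<close>
  have D': "(1 - \<epsilon>) * ?D + \<epsilon>\<^sup>2 * ?p \<le> (1 + relative_error \<epsilon> (Suc i)) * ((1 - \<epsilon>) ^ Suc i * \<Delta>)"
  proof -
    have "\<epsilon>\<^sup>2 * ?p = (\<epsilon> * \<epsilon> * (1 - \<epsilon>) ^ i) * ((1 - \<epsilon>) ^ i * \<Delta>)"
      by (simp add: palette_scale_def power2_eq_square mult_2 power_add)
    also have "\<dots> \<le> (48 * \<epsilon> * ?d * (1 - \<epsilon>)) * ((1 - \<epsilon>) ^ i * \<Delta>)"
    proof (intro mult_right_mono)
      have "\<epsilon> * \<epsilon> * (1 - \<epsilon>) ^ i \<le> \<epsilon> * ?d * 1" using eps d a1 by (intro mult_mono) auto
      also have "\<dots> \<le> \<epsilon> * ?d * (48 * (1 - \<epsilon>))" using eps d by (intro mult_left_mono) auto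
      also have "\<dots> = 48 * \<epsilon> * ?d * (1 - \<epsilon>)" by (simp only: mult_ac)
      finally show "\<epsilon> * \<epsilon> * (1 - \<epsilon>) ^ i \<le> 48 * \<epsilon> * ?d * (1 - \<epsilon>)" .
    qed (use a1 Delta_pos in simp)
    finally show ?thesis unfolding d' by (simp add: algebra_simps)
  qed
  have "measure_pmf.prob (nibble_round E \<Delta> \<epsilon> st) (- {st'. round_inv V E \<Delta> \<epsilon> (Suc i) st'}) \<le>
      measure_pmf.prob (nibble_round E \<Delta> \<epsilon> st) (- {st'. nibble_inv V E \<Delta> \<epsilon> ((1 - \<epsilon>)\<^sup>2 * ?p)
      ((1 + 48 * \<epsilon>) * ?d) ((1 - \<epsilon>) * ?D + \<epsilon>\<^sup>2 * ?p) (?F + 12 * (\<epsilon> * sqrt \<epsilon> * \<Delta>)) st'})"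
    using nibble_inv_mono[OF _ D' order_refl] unfolding round_inv_def p' d' F'
    by (intro measure_pmf.finite_measure_mono) auto
  also have "\<dots> \<le> (3 * real (card V) + 2 * real (card E) + 2 * real (card V * card (color_range \<Delta> \<epsilon>))) *
      exp (- (\<epsilon> ^ 4 * ?p) / 2)"
    using inv[unfolded round_inv_def] graph D eps d palette_scale_ge[OF i] palette_scale_le
    by (rule prob_round_breaks_inv_le)
  also have "\<dots> \<le> round_failure"
    unfolding round_failure_def using palette_scale_ge(1)[OF i] eps by (intro mult_left_mono) auto
  finally show ?thesis .
qed

lemma prob_round_inv:
  assumes "i \<le> t_eps \<epsilon>"
  shows "measure_pmf.prob (nibble_rounds E \<Delta> \<epsilon> i) (- {st. round_inv V E \<Delta> \<epsilon> i st}) \<le> real i * round_failure"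
  using assms
proof (induction i)
  case 0
  then show ?case using round_inv_initial by (simp add: measure_return_pmf)
next
  case (Suc i)
  have "0 \<le> round_failure" by (simp add: round_failure_def)
  then have "measure_pmf.prob (nibble_rounds E \<Delta> \<epsilon> (Suc i)) (- {st. round_inv V E \<Delta> \<epsilon> (Suc i) st}) \<le>
    measure_pmf.prob (nibble_rounds E \<Delta> \<epsilon> i) (- {st. round_inv V E \<Delta> \<epsilon> i st}) + round_failure"
    unfolding nibble_rounds.simps using prob_round_inv_step Suc.prems
    by (intro prob_bind_pmf_le) auto
  then show ?case using Suc by (simp add: algebra_simps)
qed

text \<open>Everything is compared with powers of \<open>m\<close>: at most \<open>2 * m^2\<close>
  rounds, \<open>12 * m^3\<close> events per round, and probability \<open>1 / m^11\<close> for each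
  event.\<close>

lemma total_failure_le: "real (t_eps \<epsilon>) * round_failure \<le> 1 / real (card V)"
proof -
  define m where "m = real (card V)"
  have m: "2 \<le> m" using n by (simp add: m_def)
  have E: "real (card E) \<le> m\<^sup>2"
  proof -
    have "E \<subseteq> (\<lambda>(x, y). {x, y}) ` (V \<times> V)"
    proof
      fix e assume "e \<in> E"
      then have "card e = 2" "e \<subseteq> V" using graph by (auto simp: simple_graph_def)
      then obtain a b where "e = {a, b}" by (auto simp: card_2_iff)
      then show "e \<in> (\<lambda>(x, y). {x, y}) ` (V \<times> V)" using \<open>e \<subseteq> V\<close> by force
    qed
    then have "card E \<le> card (V \<times> V)" using finite_V by (intro surj_card_le) auto
    then have "real (card E) \<le> real (card V * card V)"
      by (simp only: card_cartesian_product of_nat_le_iff)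
    then show ?thesis by (simp add: m_def power2_eq_square)
  qed
  \<comment> \<open>Any vertex has degree at least about \<open>\<Delta>\<close> and at most the
    number of edges.\<close>
  have Delta: "\<Delta> \<le> 2 * m\<^sup>2"
  proof -
    obtain v where v: "v \<in> V" using n by fastforce
    have "vertex_degree E v \<le> card E" unfolding vertex_degree_def using finite_E by (intro card_mono) auto
    then have "(1 - \<epsilon>\<^sup>2) * \<Delta> \<le> m\<^sup>2" using degrees(1)[OF v] E by linarith
    moreover have "\<epsilon>\<^sup>2 \<le> 1 / 2"
      using eps mult_mono[of \<epsilon> "1/2" \<epsilon> 1] by (simp add: power2_eq_square)
    then have "1 / 2 * \<Delta> \<le> (1 - \<epsilon>\<^sup>2) * \<Delta>" using Delta_pos by (intro mult_right_mono) auto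
    ultimately show ?thesis by linarith
  qed
  have colors: "real (card (color_range \<Delta> \<epsilon>)) \<le> 4 * m\<^sup>2"
  proof -
    have "(1 + \<epsilon>\<^sup>2) * \<Delta> \<le> 2 * (2 * m\<^sup>2)"
      using Delta Delta_pos eps by (intro mult_mono) (auto simp: power_le_one)
    then show ?thesis using real_card_color_range(1)[of \<epsilon> \<Delta>] Delta_pos by simp
  qed
  \<comment> \<open>The number of rounds is at most \<open>1 / \<epsilon>^2\<close>, hence at most
    \<open>1 / \<epsilon>^6\<close>, which is bounded by \<open>\<Delta>\<close>.\<close>
  have "t_eps \<epsilon> \<le> 2 * m\<^sup>2"
  proof -
    have "real (t_eps \<epsilon>) * \<epsilon> \<le> ell / 96" by (rule rounds_le) simp
    also have "\<dots> \<le> ell" using ell_pos by simp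
    also have "\<dots> \<le> 1 / \<epsilon>" using eps ln_bound[of "1 / \<epsilon>"] by (simp add: ell_def)
    finally have "real (t_eps \<epsilon>) \<le> 1 / \<epsilon> / \<epsilon>" using eps by (simp add: pos_le_divide_eq)
    also have "\<dots> = 1 / \<epsilon>\<^sup>2" by (simp add: power2_eq_square)
    also have "\<dots> \<le> 1 / \<epsilon> ^ 6" using eps by (intro divide_left_mono power_decreasing) auto
    finally show ?thesis using Delta_ge Delta by linarith
  qed
  have counts: "3 * real (card V) + 2 * real (card E) + 2 * real (card V * card (color_range \<Delta> \<epsilon>)) \<le> 12 * m ^ 3"
  proof -
    have "m * 1 \<le> m\<^sup>2" using m unfolding power2_eq_square by (intro mult_left_mono) auto
    moreover have "2 * m\<^sup>2 \<le> m * m\<^sup>2" using m by (intro mult_right_mono) auto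
    moreover have "m * real (card (color_range \<Delta> \<epsilon>)) \<le> m * (4 * m\<^sup>2)"
      using colors m by (intro mult_left_mono) auto
    ultimately show ?thesis using E by (simp add: m_def[symmetric] power3_eq_cube power2_eq_square)
  qed
  \<comment> \<open>The factor \<open>10 ^ 6\<close> leaves far more than 11; the exponent 11
    suffices because the remaining factor \<open>24 / m^5\<close> is at most 1 for
    \<open>m \<ge> 2\<close>.\<close>
  have "exp (- (\<epsilon> ^ 4 * (sqrt \<epsilon> * \<Delta>)) / 2) \<le> exp (- (11 * ln m))"
  proof -
    have "\<epsilon> * \<epsilon> \<le> 1 * sqrt \<epsilon>"
    proof (intro mult_mono)
      have "sqrt \<epsilon> * sqrt \<epsilon> \<le> sqrt \<epsilon> * 1" using sqrt_eps_small eps by (intro mult_left_mono) auto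
      then show "\<epsilon> \<le> sqrt \<epsilon>" using eps by simp
    qed (use eps in auto)
    then have "\<epsilon> ^ 4 * (\<epsilon>\<^sup>2 * \<Delta>) \<le> \<epsilon> ^ 4 * (sqrt \<epsilon> * \<Delta>)"
      using eps Delta_pos by (intro mult_left_mono mult_right_mono) (auto simp: power2_eq_square)
    moreover have "\<epsilon> ^ 4 * (\<epsilon>\<^sup>2 * \<Delta>) = \<epsilon> ^ 6 * \<Delta>" by (simp add: mult.assoc[symmetric] power_add[symmetric])
    moreover have "0 \<le> ln m" using m by simp
    ultimately show ?thesis using Delta_large by (simp add: m_def)
  qed
  also have "\<dots> = 1 / m ^ 11"
  proof -
    have "m ^ 11 = exp (11 * ln m)" using m by (simp add: powr_realpow[symmetric] powr_def)
    then show ?thesis by (simp add: exp_minus divide_inverse)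
  qed
  finally have "round_failure \<le> 12 * m ^ 3 * (1 / m ^ 11)"
    unfolding round_failure_def using counts m by (intro mult_mono) auto
  then have "real (t_eps \<epsilon>) * round_failure \<le> (2 * m\<^sup>2) * (12 * m ^ 3 * (1 / m ^ 11))"
    using \<open>t_eps \<epsilon> \<le> 2 * m\<^sup>2\<close> m by (intro mult_mono) (auto simp: round_failure_def)
  also have "\<dots> = 24 / m ^ 5 * (1 / m)" using m by (simp add: field_simps power_numeral_reduce)
  also have "\<dots> \<le> 1 * (1 / m)"
  proof (intro mult_right_mono)
    have "2 ^ 5 \<le> m ^ 5" using m by (intro power_mono) auto
    then show "24 / m ^ 5 \<le> 1" using m by (simp add: divide_le_eq)
  qed (use m in simp)
  finally show ?thesis by (simp add: m_def)
qed

text \<open>Of the constant 4, unsampled edges take 3 and failed edges take 1. The exponent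
  \<open>ell / 144\<close> corresponds to \<open>3 * nibble_K\<close>.\<close>

lemma leftover_degree_le:
  assumes inv: "round_inv V E \<Delta> \<epsilon> (t_eps \<epsilon> - 1) st" and v: "v \<in> V"
  shows "real (vertex_degree (leftover_edges st) v) \<le> 4 * \<epsilon> powr (1 / (3 * nibble_K)) * \<Delta>"
proof -
  let ?i = "t_eps \<epsilon> - 1"
  let ?b = "exp (- (ell / 144))"
  have inv': "real (vertex_degree (unsampled st) v) \<le> (1 + relative_error \<epsilon> ?i) * ((1 - \<epsilon>) ^ ?i * \<Delta>)"
    "real (vertex_degree (failed st) v) \<le> real ?i * (12 * (\<epsilon> * sqrt \<epsilon> * \<Delta>))"
    using inv v by (auto simp: round_inv_def nibble_inv_def)
  have "{e \<in> leftover_edges st. v \<in> e} = {e \<in> unsampled st. v \<in> e} \<union> {e \<in> failed st. v \<in> e}"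
    by (auto simp: leftover_edges_def)
  then have "vertex_degree (leftover_edges st) v \<le> vertex_degree (unsampled st) v + vertex_degree (failed st) v"
    unfolding vertex_degree_def by (simp add: card_Un_le)
  moreover have "(1 + relative_error \<epsilon> ?i) * ((1 - \<epsilon>) ^ ?i * \<Delta>) \<le> 2 * (3 / 2 * ?b * \<Delta>)"
  proof (intro mult_mono)
    show "1 + relative_error \<epsilon> ?i \<le> 2" using relative_error_le[of ?i] by simp
    \<comment> \<open>The floor in \<open>t_eps\<close> and stopping one round earlier cost at most
      two rounds, paid for by the factor \<open>exp (2 * \<epsilon>) \<le> 3 / 2\<close>.\<close>
    have "ell / (96 * \<epsilon>) < real (t_eps \<epsilon>) + 1"
      unfolding t_eps_def nibble_K_def ell_def by (simp add: of_nat_nat) linarith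
    then have "ell / (96 * \<epsilon>) * \<epsilon> \<le> (real ?i + 2) * \<epsilon>" using eps by (intro mult_right_mono) auto
    then have t: "ell / 96 - 2 * \<epsilon> \<le> real ?i * \<epsilon>" using eps by (simp add: algebra_simps)
    have "(1 - \<epsilon>) ^ ?i \<le> exp (- \<epsilon>) ^ ?i"
      using eps exp_ge_add_one_self[of "- \<epsilon>"] by (intro power_mono) auto
    also have "\<dots> = exp (- (real ?i * \<epsilon>))" by (simp add: exp_of_nat_mult[symmetric])
    also have "\<dots> \<le> exp (2 * \<epsilon> + - (ell / 144))" using t ell_pos by simp
    also have "\<dots> = exp (2 * \<epsilon>) * ?b" by (rule exp_add)
    also have "\<dots> \<le> 3 / 2 * ?b"
    proof (intro mult_right_mono)
      show "exp (2 * \<epsilon>) \<le> 3 / 2" using real_exp_bound_lemma[of "2 * \<epsilon>"] eps by simp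
    qed simp
    finally show "(1 - \<epsilon>) ^ ?i \<le> 3 / 2 * ?b" .
  qed (use eps Delta_pos in auto)
  moreover have "real ?i * (12 * (\<epsilon> * sqrt \<epsilon> * \<Delta>)) \<le> ?b * \<Delta>"
  proof -
    have "real ?i * (12 * (\<epsilon> * sqrt \<epsilon> * \<Delta>)) = 12 * (real ?i * \<epsilon>) * (sqrt \<epsilon> * \<Delta>)" by simp
    also have "\<dots> \<le> 12 * (ell / 96) * (sqrt \<epsilon> * \<Delta>)"
      using rounds_le[of ?i] eps Delta_pos by (intro mult_right_mono mult_left_mono) auto
    also have "\<dots> = (ell / 8 * sqrt \<epsilon>) * \<Delta>" by simp
    also have "\<dots> \<le> ?b * \<Delta>"
    proof (intro mult_right_mono)
      \<comment> \<open>The logarithmic factor is absorbed by a small part of the decay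
        \<open>exp (- (ell / 2))\<close> of \<open>sqrt \<epsilon>\<close>.\<close>
      have "ell / 8 \<le> exp (ell / 8)" using exp_ge_add_one_self[of "ell / 8"] by linarith
      then have "ell / 8 * sqrt \<epsilon> \<le> exp (ell / 8) * sqrt \<epsilon>" using eps by (intro mult_right_mono) auto
      also have "\<dots> = exp (- (3 * ell / 8))" unfolding exp_ell(3) by (simp add: exp_add[symmetric])
      also have "\<dots> \<le> ?b" using ell_pos by simp
      finally show "ell / 8 * sqrt \<epsilon> \<le> ?b" .
    qed (use Delta_pos in simp)
    finally show ?thesis .
  qed
  ultimately have "real (vertex_degree (leftover_edges st) v) \<le> 4 * ?b * \<Delta>"
    using inv' by linarith
  then show ?thesis unfolding exp_ell(2) by (simp add: nibble_K_def)
qed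

lemma prob_leftover_degree_ge:
  "measure_pmf.prob (phase_one E \<Delta> \<epsilon>)
    {st. real (max_degree V (leftover_edges st)) \<le> 4 * \<epsilon> powr (1 / (3 * nibble_K)) * \<Delta>}
    \<ge> 1 - 1 / real (card V)"
proof -
  let ?i = "t_eps \<epsilon> - 1"
  let ?G = "{st. real (max_degree V (leftover_edges st)) \<le> 4 * \<epsilon> powr (1 / (3 * nibble_K)) * \<Delta>}"
  let ?I = "{st. round_inv V E \<Delta> \<epsilon> ?i st}"
  have "?I \<subseteq> ?G"
  proof
    fix st assume "st \<in> ?I"
    then have le: "real (vertex_degree (leftover_edges st) v) \<le> 4 * \<epsilon> powr (1 / (3 * nibble_K)) * \<Delta>" if "v \<in> V" for v
      using leftover_degree_le that by blast
    have V: "V \<noteq> {}" using n by auto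
    have "max_degree V (leftover_edges st) \<in> vertex_degree (leftover_edges st) ` V"
      unfolding max_degree_def using finite_V V by (metis Max_in Sup_nat_def finite_imageI image_is_empty)
    then show "st \<in> ?G" using le by auto
  qed
  then have "measure_pmf.prob (phase_one E \<Delta> \<epsilon>) ?I \<le> measure_pmf.prob (phase_one E \<Delta> \<epsilon>) ?G"
    by (intro measure_pmf.finite_measure_mono) auto
  moreover have "measure_pmf.prob (phase_one E \<Delta> \<epsilon>) ?I = 1 - measure_pmf.prob (phase_one E \<Delta> \<epsilon>) (- ?I)"
    using measure_pmf.prob_compl[of ?I "phase_one E \<Delta> \<epsilon>"] by (simp add: Compl_eq_Diff_UNIV)
  moreover have "measure_pmf.prob (phase_one E \<Delta> \<epsilon>) (- ?I) \<le> real ?i * round_failure"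
    unfolding phase_one_def by (rule prob_round_inv) simp
  moreover have "real ?i * round_failure \<le> real (t_eps \<epsilon>) * round_failure"
    by (intro mult_right_mono) (auto simp: round_failure_def)
  ultimately show ?thesis using total_failure_le by linarith
qed

end

theorem theorem2p2:
  shows "\<exists>C c :: real. C > 0 \<and> c > 0 \<and>
    (\<forall>(V :: 'a set) (E :: 'a set set) (\<Delta> :: real) (\<epsilon> :: real).
       simple_graph V E \<longrightarrow>
       \<Delta> > 0 \<longrightarrow>
       \<epsilon> \<le> 10 powr (-4) \<longrightarrow>
       \<epsilon> \<ge> 10 * (ln (real (card V)) / \<Delta>) powr (1 / 6) \<longrightarrow>
       (\<forall>v\<in>V. (1 - \<epsilon>\<^sup>2) * \<Delta> \<le> real (vertex_degree E v) \<and> real (vertex_degree E v) \<le> (1 + \<epsilon>\<^sup>2) * \<Delta>) \<longrightarrow>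
       measure_pmf.prob (phase_one E \<Delta> \<epsilon>)
         {st. real (max_degree V (leftover_edges st)) \<le> C * \<epsilon> powr (1 / (3 * nibble_K)) * \<Delta>}
       \<ge> 1 - 1 / real (card V) powr c)"
proof (rule exI[of _ 4], rule exI[of _ 1], intro conjI allI impI)
  \<comment> \<open>The witnesses are the constant of \<open>leftover_degree_le\<close> and the
    exponent of \<open>total_failure_le\<close>.\<close>
  fix V :: "'a set" and E :: "'a set set" and \<Delta> \<epsilon> :: real
  assume graph: "simple_graph V E" and Delta: "\<Delta> > 0" and eps_le: "\<epsilon> \<le> 10 powr (-4)"
    and eps_ge: "\<epsilon> \<ge> 10 * (ln (real (card V)) / \<Delta>) powr (1 / 6)"
    and deg: "\<forall>v\<in>V. (1 - \<epsilon>\<^sup>2) * \<Delta> \<le> real (vertex_degree E v) \<and> real (vertex_degree E v) \<le> (1 + \<epsilon>\<^sup>2) * \<Delta>"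
  let ?G = "{st. real (max_degree V (leftover_edges st)) \<le> 4 * \<epsilon> powr (1 / (3 * nibble_K)) * \<Delta>}"
  have "finite V" using graph by (simp add: simple_graph_def)
  then have "V = {} \<or> card V = 1 \<or> 2 \<le> card V" using card_0_eq[of V] by linarith
  then consider "V = {}" | "card V = 1" | "2 \<le> card V" by blast
  then show "measure_pmf.prob (phase_one E \<Delta> \<epsilon>) ?G \<ge> 1 - 1 / real (card V) powr 1"
  proof cases
    case 1
    \<comment> \<open>Division by zero makes the demanded probability 1, but the maximum degree over
      the empty set is 0.\<close>
    have "?G = UNIV" using 1 Delta by (simp add: max_degree_def)
    then show ?thesis by simp
  next
    case 2
    \<comment> \<open>For one vertex the demanded probability is 0.\<close>
    then show ?thesis by simp
  next
    case 3
    define x where "x = ln (real (card V)) / \<Delta>"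
    have x: "0 < x" using 3 Delta by (simp add: x_def)
    have ge: "10 * x powr (1 / 6) \<le> \<epsilon>" using eps_ge by (simp add: x_def)
    have "0 < x powr (1 / 6)" using x by simp
    then have pos: "0 < \<epsilon>" using ge by linarith
    \<comment> \<open>Taking sixth powers turns the lower bound on \<open>\<epsilon>\<close> into
      \<open>Delta_large\<close>.\<close>
    have "(x powr (1 / 6)) ^ 6 = (x powr (1 / 6)) powr (real 6)" using x by (subst powr_realpow) auto
    also have "\<dots> = x" using x by (simp add: powr_powr)
    finally have "(10 * x powr (1 / 6)) ^ 6 = 10 ^ 6 * x" by (simp add: power_mult_distrib)
    moreover have "(10 * x powr (1 / 6)) ^ 6 \<le> \<epsilon> ^ 6" using ge by (intro power_mono) auto
    ultimately have "10 ^ 6 * x * \<Delta> \<le> \<epsilon> ^ 6 * \<Delta>" using Delta by (intro mult_right_mono) auto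
    then have large: "10 ^ 6 * ln (real (card V)) \<le> \<epsilon> ^ 6 * \<Delta>" using Delta by (simp add: x_def)
    have "(10 :: real) powr 4 = 10 ^ 4" by (rule powr_numeral) simp
    then have "(10 :: real) powr (-4) = 1 / 10000" unfolding powr_minus by simp
    then have "\<epsilon> \<le> 1 / 10000" using eps_le by simp
    then interpret nibble_parameters V E \<Delta> \<epsilon>
      using graph 3 pos large deg by unfold_locales auto
    show ?thesis using prob_leftover_degree_ge by simp
  qed
qed auto

end
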